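(* Let $d\in\mathbb{N}$, $n\in\mathbb{N}$ with $n\ge1$, and $0<\beta<1$. Let $B^{\beta}=B^{\beta,\beta}$ be the $d$-dimensional grey Brownian motion, with form factor $$S^{\beta,\beta}(k):=\frac{1}{n^{2}}\int_{0}^{n}dt\int_{0}^{n}ds\,\mathbb{E}\left(e^{i(k,B^{\beta}(t)-B^{\beta}(s))}\right),\quad k\in\mathbb{R}^{d}.$$ Then $S^{\beta,\beta}(k)=f_{D}(y;\beta,\beta)$ with $y^{2}=\frac{n^{\beta}|k|^{2}}{2}$, where the Debye function is $$f_{D}(y;\beta,\beta)=2\sum_{j=0}^{\infty}\frac{(-y^{2})^{j}}{\Gamma(\beta j+1)(\beta j+1)(\beta j+2)}=2E_{\beta,3}(-y^{2}).$$
   Context: Mittag-Leffler function and generalized Mittag-Leffler function: $E_{\beta,\rho}(z)=\sum_{j=0}^{\infty}\frac{z^{j}}{\Gamma(\beta j+\rho)}$ and $E_{\beta}(z)=E_{\beta,1}(z)$, for $z\in\mathbb{C}$, $\beta>0$, $\rho\in\mathbb{C}$. Mittag-Leffler measure: let $S_{d}=S(\mathbb{R})\otimes\mathbb{R}^{d}$ (Schwartz functions $\varphi=(\varphi_{1},\dots,\varphi_{d})$) with dual $S_{d}'=S'(\mathbb{R})\otimes\mathbb{R}^{d}$ (elements $w=(w_1,\dots,w_d)$), dual pairing $\langle w,\varphi\rangle_{0}=\sum_{j=1}^{d}\langle w_{j},\varphi_{j}\rangle$ extending the $L^2$ inner product, and norm $|\varphi|_{0}^{2}=\sum_{j=1}^{d}|\varphi_{j}|_{L^{2}(\mathbb{R})}^{2}$.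 For $\beta\in(0,1]$, $\mu_{\beta}$ is the unique probability measure on $S_{d}'$ (with the $\sigma$-algebra generated by cylinder sets) such that $\int_{S_{d}'}e^{i\langle w,\varphi\rangle_{0}}\,d\mu_{\beta}(w)=E_{\beta}\left(-\frac{1}{2}|\varphi|_{0}^{2}\right)$ for all $\varphi\in S_{d}$. Expectation $\mathbb{E}$ is with respect to $\mu_{\beta}$. Since $\int\langle w,\varphi\rangle_{0}^{2}\,d\mu_{\beta}(w)=\frac{1}{\Gamma(\beta+1)}|\varphi|_{0}^{2}$, the map $\varphi\mapsto\langle\cdot,\varphi\rangle_{0}\in L^{2}(\mu_{\beta})$ extends by continuity to all $\varphi\in L^{2}(\mathbb{R})\otimes\mathbb{R}^{d}$. Grey Brownian motion: for $0<\alpha<2$ and $t\ge 0$, let $M_{-}^{\alpha/2}1_{[0,t)}\in L^{2}(\mathbb{R})$ be the function $x\mapsto\frac{K_{\alpha/2}}{\Gamma((\alpha+1)/2)}\left((t-x)_{+}^{(\alpha-1)/2}-(-x)_{+}^{(\alpha-1)/2}\right)$, with $K_{\alpha/2}=\sqrt{\alpha\sin(\alpha\pi/2)\Gamma(\alpha)}$ (equal to $1_{[0,t)}$ a.e. if $\alpha=1$; here $u_+^{p}=u^{p}$ for $u>0$ and $0$ for $u\le0$). It is a known fact that $\left(M_{-}^{\alpha/2}1_{[0,t)},M_{-}^{\alpha/2}1_{[0,s)}\right)_{L^{2}}=\frac{1}{2}\left(t^{\alpha}+s^{\alpha}-|t-s|^{\alpha}\right)$ for all $s,t\ge 0$. The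 $d$-dimensional generalized grey Brownian motion is $B^{\beta,\alpha}(t,w)=\left(\langle w_{1},M_{-}^{\alpha/2}1_{[0,t)}\rangle,\dots,\langle w_{d},M_{-}^{\alpha/2}1_{[0,t)}\rangle\right)$, each component being an element of $L^{2}(\mu_{\beta})$; grey Brownian motion is the case $\alpha=\beta$. $(\cdot,\cdot)$ and $|\cdot|$ on $\mathbb{R}^{d}$ denote the Euclidean inner product and norm. *)

theory Defs
  imports "HOL-Probability.Probability"
begin

section \<open>Mittag-Leffler functions\<close>

text \<open>At the poles of \<open>\<Gamma>\<close> the library has \<open>Gamma z = 0\<close>, and \<open>z / 0 = 0\<close>, which agrees with the
  convention \<open>1 / \<Gamma> = 0\<close> there.\<close>

definition mittag_leffler :: "real \<Rightarrow> complex \<Rightarrow> complex \<Rightarrow> complex" where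
  "mittag_leffler \<beta> \<rho> z = (\<Sum>j. z ^ j / Gamma (of_real (\<beta> * real j) + \<rho>))"

section \<open>Schwartz functions and tempered distributions\<close>

definition schwartz :: "(real \<Rightarrow> real) set" where
  "schwartz = {f. (\<forall>n x. (deriv ^^ n) f differentiable at x) \<and>
                  (\<forall>m n. bounded (range (\<lambda>x. x ^ m * (deriv ^^ n) f x)))}"

definition schwartz_seminorm :: "nat \<Rightarrow> nat \<Rightarrow> (real \<Rightarrow> real) \<Rightarrow> real" where
  "schwartz_seminorm m n f = (SUP x. \<bar>x ^ m * (deriv ^^ n) f x\<bar>)"

definition schwartz_topology :: "(real \<Rightarrow> real) topology" where
  "schwartz_topology = topology_generated_by
     {U. \<exists>\<phi>\<in>schwartz. \<exists>m n e. e > 0 \<and>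
         U = {\<psi>\<in>schwartz. schwartz_seminorm m n (\<lambda>x. \<psi> x - \<phi> x) < e}}"

text \<open>A functional is only relevant on \<^const>\<open>schwartz\<close>; membership in \<^const>\<open>extensional\<close> makes its
  representation as a total function unique.\<close>

definition tempered :: "((real \<Rightarrow> real) \<Rightarrow> real) set" where
  "tempered = {w \<in> extensional schwartz.
     (\<forall>\<phi>\<in>schwartz. \<forall>\<psi>\<in>schwartz. \<forall>a b.
        w (\<lambda>x. a * \<phi> x + b * \<psi> x) = a * w \<phi> + b * w \<psi>) \<and>
     continuous_map schwartz_topology euclideanreal w}"

text \<open>\<open>S(\<real>) \<otimes> \<real>\<^sup>d\<close> and its dual are represented by \<open>d\<close>-tuples.\<close>

definition schwartz_vec :: "((real \<Rightarrow> real) ^ 'd) set" where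
  "schwartz_vec = {\<phi>. \<forall>j. \<phi> $ j \<in> schwartz}"

definition tempered_vec :: "(((real \<Rightarrow> real) \<Rightarrow> real) ^ 'd) set" where
  "tempered_vec = {w. \<forall>j. w $ j \<in> tempered}"

definition dual_pairing ::
  "((real \<Rightarrow> real) \<Rightarrow> real) ^ 'd \<Rightarrow> (real \<Rightarrow> real) ^ 'd \<Rightarrow> real" where
  "dual_pairing w \<phi> = (\<Sum>j\<in>UNIV. (w $ j) (\<phi> $ j))"

definition sq_norm0 :: "(real \<Rightarrow> real) ^ 'd \<Rightarrow> real" where
  "sq_norm0 \<phi> = (\<Sum>j\<in>UNIV. LBINT x. ((\<phi> $ j) x)\<^sup>2)"

section \<open>The Mittag-Leffler measure\<close>

definition cylinder_sets :: "(((real \<Rightarrow> real) \<Rightarrow> real) ^ 'd) set set" where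
  "cylinder_sets =
     {C. \<exists>(m::nat) \<phi> A. (\<forall>i<m. \<phi> i \<in> schwartz_vec) \<and> A \<in> sets (\<Pi>\<^sub>M i\<in>{..<m}. borel) \<and>
         C = {w\<in>tempered_vec. (\<lambda>i\<in>{..<m}. dual_pairing w (\<phi> i)) \<in> A}}"

definition mittag_leffler_measure ::
  "real \<Rightarrow> (((real \<Rightarrow> real) \<Rightarrow> real) ^ 'd) measure \<Rightarrow> bool" where
  "mittag_leffler_measure \<beta> \<mu> \<longleftrightarrow>
     prob_space \<mu> \<and>
     space \<mu> = tempered_vec \<and> sets \<mu> = sigma_sets tempered_vec cylinder_sets \<and>
     (\<forall>\<phi>\<in>schwartz_vec.
        (\<integral>w. exp (\<i> * complex_of_real (dual_pairing w \<phi>)) \<partial>\<mu>) =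
        mittag_leffler \<beta> 1 (complex_of_real (- (1 / 2) * sq_norm0 \<phi>)))"

section \<open>Extension of the pairing to square-integrable functions\<close>

definition L2_fun :: "'a measure \<Rightarrow> ('a \<Rightarrow> real) set" where
  "L2_fun M = {f \<in> borel_measurable M. integrable M (\<lambda>x. (f x)\<^sup>2)}"

definition L2_tendsto :: "'a measure \<Rightarrow> (nat \<Rightarrow> 'a \<Rightarrow> real) \<Rightarrow> ('a \<Rightarrow> real) \<Rightarrow> bool" where
  "L2_tendsto M g f \<longleftrightarrow> (\<lambda>m. \<integral>\<^sup>+x. ennreal ((g m x - f x)\<^sup>2) \<partial>M) \<longlonglongrightarrow> 0"

text \<open>\<open>X\<close> is a representative of the element \<open>\<langle>\<cdot>, f\<rangle>\<^sub>0\<close> of \<open>L\<^sup>2(\<mu>)\<close>, where \<open>f \<in> L\<^sup>2(\<real>) \<otimes> \<real>\<^sup>d\<close>: the extension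
  by continuity of \<open>\<phi> \<mapsto> \<langle>\<cdot>, \<phi>\<rangle>\<^sub>0\<close> sends \<open>f\<close> to the \<open>L\<^sup>2(\<mu>)\<close>-limit of \<open>\<langle>\<cdot>, \<phi>\<^sub>m\<rangle>\<^sub>0\<close> along Schwartz functions
  \<open>\<phi>\<^sub>m \<rightarrow> f\<close>. As \<open>\<parallel>\<langle>\<cdot>, \<phi>\<rangle>\<^sub>0\<parallel>\<close> is a constant multiple of \<open>|\<phi>|\<^sub>0\<close> for a Mittag-Leffler measure, the class of
  \<open>X\<close> does not depend on the approximating sequence.\<close>

definition extended_pairing ::
  "(((real \<Rightarrow> real) \<Rightarrow> real) ^ 'd) measure \<Rightarrow> (real \<Rightarrow> real) ^ 'd \<Rightarrow>
   (((real \<Rightarrow> real) \<Rightarrow> real) ^ 'd \<Rightarrow> real) \<Rightarrow> bool" where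
  "extended_pairing \<mu> f X \<longleftrightarrow>
     (\<forall>j. f $ j \<in> L2_fun lborel) \<and> X \<in> L2_fun \<mu> \<and>
     (\<exists>\<phi>. (\<forall>m. \<phi> m \<in> schwartz_vec) \<and>
          (\<forall>j. L2_tendsto lborel (\<lambda>m. \<phi> m $ j) (f $ j)) \<and>
          L2_tendsto \<mu> (\<lambda>m w. dual_pairing w (\<phi> m)) X)"

section \<open>Generalized grey Brownian motion\<close>

text \<open>\<open>(u\<^sub>+)\<^sup>p\<close>; the library's \<open>u powr p\<close> does not vanish for \<open>u < 0\<close>.\<close>

definition pos_powr :: "real \<Rightarrow> real \<Rightarrow> real" where
  "pos_powr u p = (if u > 0 then u powr p else 0)"

definition K_const :: "real \<Rightarrow> real" where
  "K_const \<alpha> = sqrt (\<alpha> * sin (\<alpha> * pi / 2) * Gamma \<alpha>)"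

text \<open>The function \<open>M\<^sub>-\<^bsup>\<alpha>/2\<^esup> 1\<^bsub>[0,t)\<^esub>\<close>.\<close>

definition M_minus_ind :: "real \<Rightarrow> real \<Rightarrow> real \<Rightarrow> real" where
  "M_minus_ind \<alpha> t x = K_const \<alpha> / Gamma ((\<alpha> + 1) / 2) *
     (pos_powr (t - x) ((\<alpha> - 1) / 2) - pos_powr (- x) ((\<alpha> - 1) / 2))"

text \<open>\<open>\<langle>w\<^sub>j, f\<rangle>\<close> is \<open>\<langle>w, f e\<^sub>j\<rangle>\<^sub>0\<close> with the \<open>j\<close>-th unit vector \<open>e\<^sub>j\<close>.\<close>

definition at_coord :: "'d \<Rightarrow> (real \<Rightarrow> real) \<Rightarrow> (real \<Rightarrow> real) ^ 'd" where
  "at_coord j f = (\<chi> i. if i = j then f else (\<lambda>_. 0))"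

text \<open>The components of \<open>B(t)\<close> are elements of \<open>L\<^sup>2(\<mu>)\<close>; the predicate holds for every choice of
  representatives.\<close>

definition gen_grey_brownian ::
  "(((real \<Rightarrow> real) \<Rightarrow> real) ^ 'd) measure \<Rightarrow> real \<Rightarrow>
   (real \<Rightarrow> ((real \<Rightarrow> real) \<Rightarrow> real) ^ 'd \<Rightarrow> real ^ 'd) \<Rightarrow> bool" where
  "gen_grey_brownian \<mu> \<alpha> B \<longleftrightarrow>
     (\<forall>t\<ge>0. \<forall>j. extended_pairing \<mu> (at_coord j (M_minus_ind \<alpha> t)) (\<lambda>w. B t w $ j))"

section \<open>Form factor and Debye function\<close>

definition form_factor ::
  "'a measure \<Rightarrow> (real \<Rightarrow> 'a \<Rightarrow> real ^ 'd) \<Rightarrow> nat \<Rightarrow> real ^ 'd \<Rightarrow> complex" where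
  "form_factor \<mu> B n k = 1 / (of_nat n)\<^sup>2 *
     (LBINT t:{0..real n}. LBINT s:{0..real n}.
        (\<integral>w. exp (\<i> * complex_of_real (k \<bullet> (B t w - B s w))) \<partial>\<mu>))"

text \<open>The Debye function \<open>f\<^sub>D(y; \<beta>, \<beta>)\<close>.\<close>

definition debye :: "real \<Rightarrow> real \<Rightarrow> real" where
  "debye \<beta> y = 2 * (\<Sum>j. (- (y\<^sup>2)) ^ j /
     (Gamma (\<beta> * real j + 1) * (\<beta> * real j + 1) * (\<beta> * real j + 2)))"

end

theory Submission
  imports Defs
begin

text \<open>The increments of the kernels satisfy \<open>\<parallel>M\<^sub>-\<^bsup>\<beta>/2\<^esup> 1\<^bsub>[0,t)\<^esub> - M\<^sub>-\<^bsup>\<beta>/2\<^esup> 1\<^bsub>[0,s)\<^esub>\<parallel>\<^sup>2 = |t - s|\<^sup>\<beta>\<close>, which after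
  translation and scaling is a Beta integral. The characteristic function of the Mittag-Leffler
  measure passes to the \<open>L\<^sup>2\<close>-extension of the pairing, so that
  \<open>\<E> e\<^bsup>i(k, B(t) - B(s))\<^esup> = E\<^sub>\<beta>(c |t - s|\<^sup>\<beta>)\<close> with \<open>c = - |k|\<^sup>2 / 2\<close>. Since \<open>x\<^bsup>r+1\<^esup> E\<^bsub>\<beta>,r+2\<^esub>(c |x|\<^sup>\<beta>)\<close> is a
  primitive of \<open>x\<^sup>r E\<^bsub>\<beta>,r+1\<^esub>(c |x|\<^sup>\<beta>)\<close> for \<open>r = 0, 1\<close>, the double integral is evaluated by applying the
  fundamental theorem of calculus twice and equals \<open>2 n\<^sup>2 E\<^bsub>\<beta>,3\<^esub>(c n\<^sup>\<beta>)\<close>.\<close>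

section \<open>Mittag-Leffler functions of a real argument\<close>

lemma Gamma_real_plus1:
  fixes x :: real
  shows "x > 0 \<Longrightarrow> Gamma (x + 1) = x * Gamma x"
  by (rule Gamma_plus1) (auto elim!: nonpos_Ints_cases)

text \<open>On the unit interval \<open>{A..A+1}\<close> the integrand of Euler's integral is at
  least \<open>A powr (x - 1) / exp (A + 1)\<close>. Since \<open>A\<close> is free, Gamma outgrows
  every geometric sequence.\<close>

lemma powr_exp_le_Gamma:
  fixes A x :: real
  assumes "x \<ge> 1" "A > 0"
  shows "A powr (x - 1) / exp (A + 1) \<le> Gamma x"
proof -
  let ?f = "\<lambda>t. t powr (x - 1) / exp t"
  have G: "(?f has_integral Gamma x) {0..}"
    using assms by (intro Gamma_integral_real) auto
  have int: "?f integrable_on {A..A+1}"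
    using assms by (intro integrable_continuous_real continuous_intros) auto
  have "A powr (x - 1) / exp (A + 1) = integral {A..A+1} (\<lambda>_. A powr (x - 1) / exp (A + 1))"
    by simp
  also have "\<dots> \<le> integral {A..A+1} ?f"
    using assms by (intro integral_le int frac_le) (auto intro: powr_mono2)
  also have "\<dots> \<le> integral {0..} ?f"
    using assms int G by (intro integral_subset_le) (auto simp: has_integral_integrable)
  also have "\<dots> = Gamma x"
    using G by (rule integral_unique)
  finally show ?thesis .
qed

text \<open>Comparison with a geometric series whose ratio comes from the lower bound for
  Gamma.\<close>

lemma summable_mittag_leffler:
  fixes x \<beta> \<rho> :: real
  assumes "0 < \<beta>" "1 \<le> \<rho>"
  shows "summable (\<lambda>j. inverse (Gamma (\<beta> * real j + \<rho>)) * x ^ j)"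
proof -
  \<comment> \<open>Chosen so that \<open>A powr \<beta> = 2 * \<bar>x\<bar> + 1\<close>: the ratio
    \<open>\<bar>x\<bar> / A powr \<beta>\<close> is then below 1, and \<open>A\<close> is positive
    even for x = 0.\<close>
  define A where "A = (2 * \<bar>x\<bar> + 1) powr (1 / \<beta>)"
  have A: "A > 0" "A powr \<beta> = 2 * \<bar>x\<bar> + 1"
    using assms by (auto simp: A_def powr_powr)
  have q: "\<bar>x\<bar> / A powr \<beta> < 1"
    unfolding A(2) by (simp add: field_simps)
  show ?thesis
  proof (rule summable_comparison_test', rule summable_mult)
    show "summable (\<lambda>j. (\<bar>x\<bar> / A powr \<beta>) ^ j)"
      using q A by (intro summable_geometric) auto
    fix j :: nat
    have le: "A powr (\<beta> * real j + \<rho> - 1) / exp (A + 1) \<le> Gamma (\<beta> * real j + \<rho>)"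
      using assms A by (intro powr_exp_le_Gamma) (auto intro: order_trans[of _ \<rho>])
    have pos: "0 < A powr (\<beta> * real j + \<rho> - 1) / exp (A + 1)"
      using A by simp
    have "norm (inverse (Gamma (\<beta> * real j + \<rho>)) * x ^ j)
        = inverse (Gamma (\<beta> * real j + \<rho>)) * \<bar>x\<bar> ^ j"
      using less_le_trans[OF pos le] by (simp add: abs_mult power_abs)
    also have "\<dots> \<le> inverse (A powr (\<beta> * real j + \<rho> - 1) / exp (A + 1)) * \<bar>x\<bar> ^ j"
      using le pos by (intro mult_right_mono le_imp_inverse_le) auto
    also have "A powr (\<beta> * real j + \<rho> - 1) = (A powr \<beta>) ^ j * A powr (\<rho> - 1)"
      using A(1) by (simp add: powr_add[symmetric] powr_powr powr_realpow[symmetric] algebra_simps)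
    finally show "norm (inverse (Gamma (\<beta> * real j + \<rho>)) * x ^ j)
        \<le> exp (A + 1) / A powr (\<rho> - 1) * (\<bar>x\<bar> / A powr \<beta>) ^ j"
      by (simp add: field_simps)
  qed
qed

text \<open>All arguments that occur in the theorem are real. Each term is written as coefficient
  times power, so that the theorems on power series apply directly.\<close>

definition mittag_leffler_real :: "real \<Rightarrow> real \<Rightarrow> real \<Rightarrow> real" where
  "mittag_leffler_real \<beta> \<rho> x = (\<Sum>j. inverse (Gamma (\<beta> * real j + \<rho>)) * x ^ j)"

lemma mittag_leffler_of_real:
  assumes "0 < \<beta>" "1 \<le> \<rho>"
  shows "mittag_leffler \<beta> (of_real \<rho>) (of_real x) = of_real (mittag_leffler_real \<beta> \<rho> x)"
proof -
  have "(of_real x :: complex) ^ j / Gamma (of_real (\<beta> * real j) + of_real \<rho>)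
      = of_real (inverse (Gamma (\<beta> * real j + \<rho>)) * x ^ j)" for j
    using Gamma_complex_of_real[of "\<beta> * real j + \<rho>"] by (simp add: field_simps)
  then show ?thesis
    unfolding mittag_leffler_def mittag_leffler_real_def
    using suminf_of_real[OF summable_mittag_leffler[OF assms, of x], where 'a = complex] by simp
qed

text \<open>Coefficient by coefficient this is the recurrence Gamma (\<beta> j + \<rho> + 1) =
  (\<beta> j + \<rho>) Gamma (\<beta> j + \<rho>). The derivative \<open>D\<close> can stay
  abstract, since the product and chain rules later produce exactly this combination.\<close>

lemma mittag_leffler_real_deriv:
  assumes "0 < \<beta>" "1 \<le> \<rho>"
  obtains D where "(mittag_leffler_real \<beta> (\<rho> + 1) has_real_derivative D) (at x)"
    and "\<rho> * mittag_leffler_real \<beta> (\<rho> + 1) x + \<beta> * x * D = mittag_leffler_real \<beta> \<rho> x"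
proof -
  define c where "c = (\<lambda>j. inverse (Gamma (\<beta> * real j + (\<rho> + 1))))"
  have sc: "summable (\<lambda>j. c j * y ^ j)" for y
    unfolding c_def using assms by (intro summable_mittag_leffler) auto
  define D where "D = (\<Sum>j. diffs c j * x ^ j)"
  have 1: "(mittag_leffler_real \<beta> (\<rho> + 1) has_real_derivative D) (at x)"
    using termdiffs_strong_converges_everywhere[of c x] sc
    unfolding D_def c_def mittag_leffler_real_def by simp
  have "summable (\<lambda>j. diffs c j * x ^ j)"
    by (rule termdiff_converges_all) (rule sc)
  from diffs_equiv[OF this] have "(\<lambda>j. of_nat j * c j * x ^ (j - Suc 0)) sums D"
    by (simp add: D_def)
  \<comment> \<open>The factor \<open>x\<close> restores the power lost by differentiation; the term
    for j = 0 vanishes on both sides.\<close>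
  then have "(\<lambda>j. \<beta> * x * (of_nat j * c j * x ^ (j - Suc 0))) sums (\<beta> * x * D)"
    by (rule sums_mult)
  moreover have "\<beta> * x * (of_nat j * c j * x ^ (j - Suc 0)) = \<beta> * real j * (c j * x ^ j)" for j
    by (cases j) auto
  ultimately have 2: "(\<lambda>j. \<beta> * real j * (c j * x ^ j)) sums (\<beta> * x * D)"
    by simp
  have 3: "(\<lambda>j. \<rho> * (c j * x ^ j)) sums (\<rho> * mittag_leffler_real \<beta> (\<rho> + 1) x)"
    using sums_mult[OF summable_sums[OF sc[of x]], of \<rho>]
    by (simp add: mittag_leffler_real_def c_def)
  have "\<rho> * (c j * x ^ j) + \<beta> * real j * (c j * x ^ j)
      = inverse (Gamma (\<beta> * real j + \<rho>)) * x ^ j" for j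
  proof -
    have pos: "\<beta> * real j + \<rho> > 0"
      using assms by (intro add_nonneg_pos) auto
    then have "Gamma (\<beta> * real j + (\<rho> + 1)) = (\<beta> * real j + \<rho>) * Gamma (\<beta> * real j + \<rho>)"
      using Gamma_real_plus1[of "\<beta> * real j + \<rho>"] by (auto simp: add.assoc)
    then have "(\<beta> * real j + \<rho>) * c j = inverse (Gamma (\<beta> * real j + \<rho>))"
      using pos by (simp add: c_def)
    then show ?thesis
      by (metis add.commute distrib_right mult.assoc)
  qed
  with sums_add[OF 3 2] have "\<rho> * mittag_leffler_real \<beta> (\<rho> + 1) x + \<beta> * x * D = mittag_leffler_real \<beta> \<rho> x"
    by (simp add: mittag_leffler_real_def sums_iff)
  with 1 show ?thesis by (rule that)
qed

lemma continuous_on_mittag_leffler_real [continuous_intros]: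
  assumes "0 < \<beta>" "1 \<le> \<rho>" "continuous_on S f"
  shows "continuous_on S (\<lambda>x. mittag_leffler_real \<beta> \<rho> (f x))"
proof -
  have "isCont (mittag_leffler_real \<beta> \<rho>) x" for x
    using isCont_powser_converges_everywhere[OF summable_mittag_leffler[OF assms(1,2)]]
    unfolding mittag_leffler_real_def by simp
  then have "continuous_on UNIV (mittag_leffler_real \<beta> \<rho>)"
    by (simp add: continuous_at_imp_continuous_on)
  from continuous_on_compose2[OF this assms(3)] show ?thesis by simp
qed

section \<open>Primitives in the time variable and the double integral\<close>

lemma continuous_on_abs_powr [continuous_intros]:
  fixes f :: "_ \<Rightarrow> real"
  assumes "continuous_on S f" "0 < \<beta>"
  shows "continuous_on S (\<lambda>x. \<bar>f x\<bar> powr \<beta>)"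
  using assms by (intro continuous_on_powr' continuous_intros) auto

text \<open>The product and chain rules yield the left side of the identity in
  \<open>mittag_leffler_real_deriv\<close> with \<rho> = r + 1. The absolute value lets one
  primitive serve both signs of x; at 0 it may fail to be differentiable.\<close>

lemma mittag_leffler_real_primitive:
  assumes "0 < \<beta>" "x \<noteq> 0"
  shows "((\<lambda>x. x ^ Suc r * mittag_leffler_real \<beta> (real r + 2) (c * \<bar>x\<bar> powr \<beta>))
    has_real_derivative x ^ r * mittag_leffler_real \<beta> (real r + 1) (c * \<bar>x\<bar> powr \<beta>)) (at x)"
proof -
  let ?z = "c * \<bar>x\<bar> powr \<beta>"
  obtain D where D: "(mittag_leffler_real \<beta> (real r + 2) has_real_derivative D) (at ?z)"
    "(real r + 1) * mittag_leffler_real \<beta> (real r + 2) ?z + \<beta> * ?z * D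
      = mittag_leffler_real \<beta> (real r + 1) ?z"
    using mittag_leffler_real_deriv[OF assms(1), of "real r + 1" ?z] by (auto simp: add.assoc)
  have "((\<lambda>x. \<bar>x\<bar>) has_real_derivative sgn x) (at x)"
  proof (cases "x > 0")
    case True
    show ?thesis
      by (rule has_field_derivative_transform_within_open[of "\<lambda>x. x" _ _ "{0<..}"])
        (use True in auto)
  next
    case False
    show ?thesis
      by (rule has_field_derivative_transform_within_open[of "\<lambda>x. - x" _ _ "{..<0}"])
        (use False assms in \<open>auto intro!: derivative_eq_intros\<close>)
  qed
  moreover have "((\<lambda>u. u powr \<beta>) has_real_derivative \<beta> * \<bar>x\<bar> powr (\<beta> - 1)) (at \<bar>x\<bar>)"
    using assms by (intro has_real_derivative_powr) auto
  ultimately have "((\<lambda>x. \<bar>x\<bar> powr \<beta>) has_real_derivative \<beta> * \<bar>x\<bar> powr (\<beta> - 1) * sgn x) (at x)"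
    by (rule DERIV_chain2[rotated])
  then have "((\<lambda>x. c * \<bar>x\<bar> powr \<beta>) has_real_derivative c * (\<beta> * \<bar>x\<bar> powr (\<beta> - 1) * sgn x)) (at x)"
    by (rule DERIV_cmult)
  from DERIV_mult[OF DERIV_pow[of "Suc r"] DERIV_chain2[OF D(1) this]]
  have "((\<lambda>x. x ^ Suc r * mittag_leffler_real \<beta> (real r + 2) (c * \<bar>x\<bar> powr \<beta>)) has_real_derivative
     (real (Suc r) * x ^ r) * mittag_leffler_real \<beta> (real r + 2) ?z
      + D * (c * (\<beta> * \<bar>x\<bar> powr (\<beta> - 1) * sgn x)) * x ^ Suc r) (at x)"
    by simp
  \<comment> \<open>One factor of \<open>x ^ Suc r\<close> turns the inner derivative back into
    \<open>\<beta> * ?z\<close>.\<close>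
  moreover have "x * (\<bar>x\<bar> powr (\<beta> - 1) * sgn x) = \<bar>x\<bar> powr \<beta>"
    using assms by (simp add: powr_diff sgn_real_def abs_if)
  then have "D * (c * (\<beta> * \<bar>x\<bar> powr (\<beta> - 1) * sgn x)) * x ^ Suc r = x ^ r * (\<beta> * ?z * D)"
    by (simp add: mult_ac)
  moreover have "(real (Suc r) * x ^ r) * mittag_leffler_real \<beta> (real r + 2) ?z + x ^ r * (\<beta> * ?z * D)
    = x ^ r * mittag_leffler_real \<beta> (real r + 1) ?z"
    unfolding D(2)[symmetric] by (simp add: algebra_simps)
  ultimately show ?thesis
    by metis
qed

text \<open>Admits finitely many cusps of the integrand inside the interval, as at s = t in the
  inner time integral.\<close>

lemma LBINT_FTC_except_finite:
  fixes f F :: "real \<Rightarrow> real"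
  assumes "finite S" "a \<le> b" "continuous_on {a..b} f" "continuous_on {a..b} F"
    and "\<And>x. x \<in> {a<..<b} - S \<Longrightarrow> (F has_real_derivative f x) (at x)"
  shows "(LBINT x:{a..b}. f x) = F b - F a"
proof -
  have "(f has_integral (F b - F a)) {a..b}"
    using assms by (intro fundamental_theorem_of_calculus_interior_strong[of S])
      (auto simp: has_real_derivative_iff_has_vector_derivative)
  moreover have "set_integrable lborel {a..b} f"
    by (rule borel_integrable_atLeastAtMost') fact
  ultimately show ?thesis
    by (simp add: set_borel_integral_eq_integral integral_unique)
qed

text \<open>The primitive for r = 0, translated by t, with s = t as the only exceptional point. At
  the lower endpoint its factor is -t, which gives the first summand its positive sign.\<close>

lemma LBINT_mittag_leffler_abs_diff:
  assumes "0 < \<beta>" "0 \<le> t" "t \<le> n"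
  shows "(LBINT s:{0..n}. mittag_leffler_real \<beta> 1 (c * \<bar>t - s\<bar> powr \<beta>))
    = t * mittag_leffler_real \<beta> 2 (c * \<bar>t\<bar> powr \<beta>)
      + (n - t) * mittag_leffler_real \<beta> 2 (c * \<bar>n - t\<bar> powr \<beta>)"
proof -
  let ?F = "\<lambda>s. (s - t) * mittag_leffler_real \<beta> 2 (c * \<bar>s - t\<bar> powr \<beta>)"
  have "(LBINT s:{0..n}. mittag_leffler_real \<beta> 1 (c * \<bar>t - s\<bar> powr \<beta>)) = ?F n - ?F 0"
  proof (rule LBINT_FTC_except_finite[of "{t}"])
    fix s assume "s \<in> {0<..<n} - {t}"
    then have "s - t \<noteq> 0" by simp
    from DERIV_shift[of "\<lambda>s. s * mittag_leffler_real \<beta> 2 (c * \<bar>s\<bar> powr \<beta>)" _ s "- t"]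
      mittag_leffler_real_primitive[OF assms(1) this, of 0 c]
    show "(?F has_real_derivative mittag_leffler_real \<beta> 1 (c * \<bar>t - s\<bar> powr \<beta>)) (at s)"
      by (simp add: abs_minus_commute)
  qed (use assms in \<open>auto intro!: continuous_intros\<close>)
  then show ?thesis by simp
qed

text \<open>With \<open>?G\<close> the primitive for r = 1, the second summand is the first one
  reflected by t -> n - t, so \<open>?G t - ?G (n - t)\<close> is a primitive of the sum. As
  \<open>?G 0 = 0\<close>, each endpoint contributes \<open>?G n\<close>.\<close>

lemma LBINT_mittag_leffler_two:
  assumes "0 < \<beta>" "0 \<le> n"
  shows "(LBINT t:{0..n}. t * mittag_leffler_real \<beta> 2 (c * \<bar>t\<bar> powr \<beta>)
      + (n - t) * mittag_leffler_real \<beta> 2 (c * \<bar>n - t\<bar> powr \<beta>))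
    = 2 * n\<^sup>2 * mittag_leffler_real \<beta> 3 (c * n powr \<beta>)"
proof -
  let ?G = "\<lambda>t. t\<^sup>2 * mittag_leffler_real \<beta> 3 (c * \<bar>t\<bar> powr \<beta>)"
  have G: "(?G has_real_derivative t * mittag_leffler_real \<beta> 2 (c * \<bar>t\<bar> powr \<beta>)) (at t)"
    if "t \<noteq> 0" for t
    using mittag_leffler_real_primitive[OF assms(1) that, of 1 c] by (simp add: power2_eq_square)
  have "(LBINT t:{0..n}. t * mittag_leffler_real \<beta> 2 (c * \<bar>t\<bar> powr \<beta>)
      + (n - t) * mittag_leffler_real \<beta> 2 (c * \<bar>n - t\<bar> powr \<beta>)) = (?G n - ?G (n - n)) - (?G 0 - ?G (n - 0))"
  \<comment> \<open>The critical points t = 0 and t = n are endpoints, so no interior point has to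
    be excluded.\<close>
  proof (rule LBINT_FTC_except_finite[of "{}", where F = "\<lambda>t. ?G t - ?G (n - t)", THEN trans])
    fix t assume t: "t \<in> {0<..<n} - {}"
    have "((\<lambda>t. ?G (n - t)) has_real_derivative
        (n - t) * mittag_leffler_real \<beta> 2 (c * \<bar>n - t\<bar> powr \<beta>) * (- 1)) (at t)"
      by (rule DERIV_chain2[where f = ?G and g = "\<lambda>t. n - t", OF G])
        (use t in \<open>auto intro!: derivative_eq_intros\<close>)
    from DERIV_diff[OF G this] t
    show "((\<lambda>t. ?G t - ?G (n - t)) has_real_derivative
      t * mittag_leffler_real \<beta> 2 (c * \<bar>t\<bar> powr \<beta>)
        + (n - t) * mittag_leffler_real \<beta> 2 (c * \<bar>n - t\<bar> powr \<beta>)) (at t)"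
      by simp
  qed (use assms in \<open>auto intro!: continuous_intros\<close>)
  then show ?thesis using assms by simp
qed

text \<open>Applying the recurrence of Gamma twice absorbs the two linear factors of the
  denominator.\<close>

lemma debye_eq_mittag_leffler_real:
  assumes "0 < \<beta>"
  shows "debye \<beta> y = 2 * mittag_leffler_real \<beta> 3 (- (y\<^sup>2))"
proof -
  have "(- (y\<^sup>2)) ^ j / (Gamma (\<beta> * real j + 1) * (\<beta> * real j + 1) * (\<beta> * real j + 2))
      = inverse (Gamma (\<beta> * real j + 3)) * (- (y\<^sup>2)) ^ j" for j
  proof -
    define x where "x = \<beta> * real j"
    have "x \<ge> 0" using assms by (simp add: x_def)
    then have "x + 1 > 0" "x + 2 > 0" by auto
    then have "Gamma (x + 3) = (x + 2) * ((x + 1) * Gamma (x + 1))"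
      using Gamma_real_plus1[of "x + 2"] Gamma_real_plus1[of "x + 1"] by (auto simp: add.assoc)
    then show ?thesis
      unfolding x_def[symmetric] by (simp add: field_simps)
  qed
  then show ?thesis
    unfolding debye_def mittag_leffler_real_def by simp
qed


section \<open>The norm of the kernel increments\<close>

text \<open>The Beta integral is available as a gauge integral; nonnegativity of the integrand makes
  it absolutely convergent and hence a Lebesgue integral.\<close>

lemma Beta_real_LBINT:
  fixes a b :: real
  assumes "a > 0" "b > 0"
  shows "set_integrable lborel {0<..<1} (\<lambda>t. t powr (a - 1) * (1 - t) powr (b - 1))"
    and "(LBINT t:{0<..<1}. t powr (a - 1) * (1 - t) powr (b - 1)) = Beta a b"
proof -
  let ?f = "\<lambda>t. t powr (a - 1) * (1 - t) powr (b - 1)"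
  have I: "(?f has_integral Beta a b) {0<..<1}"
    using has_integral_Beta_real[OF assms] by (simp add: has_integral_Icc_iff_Ioo)
  then have "?f absolutely_integrable_on {0<..<1}"
    by (intro nonnegative_absolutely_integrable_1) (auto simp: has_integral_integrable)
  then show 1: "set_integrable lborel {0<..<1} ?f"
    unfolding set_integrable_def by (subst (asm) integrable_completion) auto
  show "(LBINT t:{0<..<1}. ?f t) = Beta a b"
    using set_borel_integral_eq_integral(2)[OF 1] I by (simp add: integral_unique)
qed

text \<open>Substitution z = u / (1 - u), under which 1 + z = 1 / (1 - u), in the Beta integral over
  the unit interval.\<close>

lemma Beta_real_LBINT_halfline:
  fixes a b :: real
  assumes "a > 0" "b > 0"
  shows "set_integrable lborel {0<..} (\<lambda>z. z powr (a - 1) * (1 + z) powr (- a - b))"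
    and "(LBINT z:{0<..}. z powr (a - 1) * (1 + z) powr (- a - b)) = Beta a b"
proof -
  let ?f = "\<lambda>z. z powr (a - 1) * (1 + z) powr (- a - b)"
  let ?g = "\<lambda>u::real. u / (1 - u)" and ?g' = "\<lambda>u::real. 1 / (1 - u)\<^sup>2"
  have eq: "?f (?g u) * ?g' u = u powr (a - 1) * (1 - u) powr (b - 1)" if "0 < u" "u < 1" for u
  proof -
    have "1 + ?g u = 1 / (1 - u)" using that by (simp add: field_simps)
    then have "?f (?g u) * ?g' u = (u powr (a - 1) / (1 - u) powr (a - 1)) * (1 - u) powr (a + b) / (1 - u) powr 2"
    proof -
      have "(1 / (1 - u)) powr (- a - b) = (1 - u) powr (a + b)"
        using powr_minus[of "1 - u" "- a - b"] by (simp add: powr_divide inverse_eq_divide add.commute)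
      with \<open>1 + ?g u = 1 / (1 - u)\<close> show ?thesis
        using that by (simp add: powr_divide)
    qed
    also have "\<dots> = u powr (a - 1) * (1 - u) powr (a + b - (a - 1) - 2)"
      using that unfolding powr_diff[of "1 - u"] by simp
    also have "a + b - (a - 1) - 2 = b - 1" by simp
    finally show ?thesis .
  qed
  have ein: "einterval 0 1 = {0<..<1}"
    by (auto simp: einterval_def)
  have int: "set_integrable lborel (einterval 0 1) (\<lambda>u. ?f (?g u) * ?g' u)"
    unfolding ein using Beta_real_LBINT(1)[OF assms]
    by (rule set_integrable_cong[THEN iffD1, rotated 3]) (use eq in \<open>auto simp del: times_divide_eq_right\<close>)
  have A: "((ereal \<circ> ?g \<circ> real_of_ereal) \<longlongrightarrow> 0) (at_right 0)"
    unfolding zero_ereal_def ereal_tendsto_simps by real_asymp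
  have B: "((ereal \<circ> ?g \<circ> real_of_ereal) \<longlongrightarrow> \<infinity>) (at_left 1)"
    unfolding one_ereal_def ereal_tendsto_simps by real_asymp
  have deriv: "(?g has_real_derivative ?g' x) (at x)" if "0 < x" "x < 1" for x
    using that by (auto intro!: derivative_eq_intros simp: power2_eq_square field_simps)
  have cont: "isCont ?f (?g x)" "isCont ?g' x" if "0 < x" "x < 1" for x
  proof -
    have "?g x > 0" using that by simp
    then show "isCont ?f (?g x)" by (intro continuous_intros) auto
    show "isCont ?g' x" using that by (intro continuous_intros) auto
  qed
  have "set_integrable lborel (einterval 0 \<infinity>) ?f"
    "(LBINT x=0..\<infinity>. ?f x) = (LBINT x=0..1. ?f (?g x) * ?g' x)"
    using deriv cont
    by (intro interval_integral_substitution_nonneg[OF _ _ _ _ _ _ A B int]; simp)+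
  moreover have "(LBINT x=0..1. ?f (?g x) * ?g' x) = Beta a b"
    unfolding Beta_real_LBINT(2)[OF assms, symmetric] ein interval_lebesgue_integral_def
    using eq by (auto intro!: set_lebesgue_integral_cong)
  moreover have "einterval 0 \<infinity> = {0<..}"
    by (auto simp: einterval_def)
  ultimately show "set_integrable lborel {0<..} ?f" "(LBINT z:{0<..}. ?f z) = Beta a b"
    by (simp_all add: interval_lebesgue_integral_def)
qed

text \<open>Since z / (1 + z) lies in (0, 1) and -p is at most 1, the power with exponent -p is at
  least z / (1 + z) itself. The factor 1 / (1 + z) gained here supplies the decay at
  infinity.\<close>

lemma powr_diff_le:
  fixes z p :: real
  assumes "0 < z" "-1 \<le> p" "p \<le> 0"
  shows "0 \<le> z powr p - (1 + z) powr p" "z powr p - (1 + z) powr p \<le> z powr p / (1 + z)"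
proof -
  show "0 \<le> z powr p - (1 + z) powr p"
    using assms by (simp add: powr_mono2')
  have "z / (1 + z) = (z / (1 + z)) powr 1"
    using assms by simp
  also have "\<dots> \<le> (z / (1 + z)) powr (- p)"
    using assms by (intro powr_mono') auto
  also have "\<dots> = (1 + z) powr p / z powr p"
    using assms by (simp add: powr_divide powr_minus field_simps)
  finally have "z powr p * (z / (1 + z)) \<le> (1 + z) powr p"
    using assms by (simp add: field_simps)
  moreover have "z powr p / (1 + z) = z powr p - z powr p * (z / (1 + z))"
    using assms by (simp add: field_simps)
  ultimately show "z powr p - (1 + z) powr p \<le> z powr p / (1 + z)"
    by simp
qed

lemma LBINT_powr_diff_square:
  fixes \<alpha> p :: real
  assumes "0 < \<alpha>" "\<alpha> < 1" and p: "p = (\<alpha> - 1) / 2"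
  shows "set_integrable lborel {0<..} (\<lambda>z. (z powr p - (1 + z) powr p)\<^sup>2)"
    and "\<alpha> * (LBINT z:{0<..}. (z powr p - (1 + z) powr p)\<^sup>2)
      = (1 - \<alpha>) * Beta ((\<alpha> + 1) / 2) (1 - \<alpha>) - 1"
proof -
  let ?D2 = "\<lambda>z. (z powr p - (1 + z) powr p)\<^sup>2"
  let ?b = "\<lambda>z. z powr p * (1 + z) powr (p - 1)"
  \<comment> \<open>\<open>\<integral> ?D2\<close> expands into individually divergent integrals; \<open>?W' = \<alpha> ?D2 + 2 p ?b\<close>, where
    \<open>?b\<close> has a Beta integral and \<open>?W\<close> falls from 1 to 0.\<close>
  let ?W = "\<lambda>z. z powr (2 * p + 1) + (1 + z) powr (2 * p + 1) - 2 * z powr (p + 1) * (1 + z) powr p"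
  have p': "-1/2 < p" "p < 0" "\<alpha> = 2 * p + 1" using assms by auto
  \<comment> \<open>The half-line Beta integrand with parameters p + 1 = (\<alpha> + 1) / 2 and -2p
    = 1 - \<alpha>.\<close>
  have b: "set_integrable lborel {0<..} ?b" "(LBINT z:{0<..}. ?b z) = Beta ((\<alpha> + 1) / 2) (1 - \<alpha>)"
    using Beta_real_LBINT_halfline[of "p + 1" "- 2 * p"] p' by (simp_all add: add_divide_distrib algebra_simps)
  \<comment> \<open>One factor of the square is bounded by \<open>z powr p / (1 + z)\<close>, the
    other by \<open>z powr p\<close>. Their product is the Beta integrand with the positive
    parameters 2p + 1 and -2p.\<close>
  show D2: "set_integrable lborel {0<..} ?D2"
  proof (rule set_integrable_bound)
    show "set_integrable lborel {0<..} (\<lambda>z. z powr (2 * p) * (1 + z) powr (-1))"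
      using Beta_real_LBINT_halfline(1)[of "2 * p + 1" "- 2 * p"] p' by simp
    show "AE z in lborel. z \<in> {0<..} \<longrightarrow> norm (?D2 z) \<le> norm (z powr (2 * p) * (1 + z) powr (-1))"
    proof (intro AE_I2 impI)
      fix z :: real assume "z \<in> {0<..}"
      then have z: "z > 0" by simp
      have "?D2 z \<le> (z powr p / (1 + z)) * z powr p"
        unfolding power2_eq_square using powr_diff_le[OF z, of p] p' z
        by (intro mult_mono) auto
      also have "\<dots> = z powr (2 * p) * (1 + z) powr (-1)"
        using z by (simp add: powr_minus powr_add[symmetric] field_simps)
      finally show "norm (?D2 z) \<le> norm (z powr (2 * p) * (1 + z) powr (-1))"
        by simp
    qed
  qed (simp add: set_borel_measurable_def)
  let ?w = "\<lambda>z. \<alpha> * ?D2 z + 2 * p * ?b z"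
  have ein: "einterval 0 \<infinity> = {0<..}"
    by (auto simp: einterval_def)
  have "(LBINT z=0..\<infinity>. ?w z) = 0 - 1"
  proof (rule interval_integral_FTC_integrable)
    fix z assume "0 < ereal z"
    then have z: "z > 0" by simp
    have e: "z powr (2 * p) = z powr p * z powr p" "(1 + z) powr (2 * p) = (1 + z) powr p * (1 + z) powr p"
      "z powr (p + 1) = z * z powr p" "(1 + z) powr (p - 1) = (1 + z) powr p / (1 + z)"
      using z powr_add[of z p p] powr_add[of "1 + z" p p] by (simp_all add: powr_add powr_diff)
    have "(?W has_real_derivative
        (2 * p + 1) * z powr (2 * p) + (2 * p + 1) * (1 + z) powr (2 * p)
        - 2 * ((p + 1) * z powr p * (1 + z) powr p + z powr (p + 1) * (p * (1 + z) powr (p - 1)))) (at z)"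
      using z by (auto intro!: derivative_eq_intros simp: algebra_simps)
    also have "(2 * p + 1) * z powr (2 * p) + (2 * p + 1) * (1 + z) powr (2 * p)
        - 2 * ((p + 1) * z powr p * (1 + z) powr p + z powr (p + 1) * (p * (1 + z) powr (p - 1))) = ?w z"
      unfolding e p'(3) using z by (simp add: field_simps power2_eq_square)
    finally show "(?W has_vector_derivative ?w z) (at z)"
      by (simp add: has_real_derivative_iff_has_vector_derivative)
    show "isCont ?w z"
      using z by (auto intro!: continuous_intros)
  next
    show "set_integrable lborel (einterval 0 \<infinity>) ?w"
      unfolding ein using b(1) D2 by (intro set_integral_add set_integrable_mult_right) auto
    show "((?W \<circ> real_of_ereal) \<longlongrightarrow> 1) (at_right 0)"
      unfolding zero_ereal_def ereal_tendsto_simps using p' by real_asymp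
    \<comment> \<open>The leading terms z^(2p+1) cancel; what remains is of order z^(2p), and p <
      0.\<close>
    show "((?W \<circ> real_of_ereal) \<longlongrightarrow> 0) (at_left \<infinity>)"
      unfolding ereal_tendsto_simps using p' by real_asymp
  qed simp
  then have "\<alpha> * (LBINT z:{0<..}. ?D2 z) + 2 * p * (LBINT z:{0<..}. ?b z) = - 1"
    using b(1) D2 by (simp add: interval_lebesgue_integral_def ein set_integral_add)
  moreover have "2 * p = \<alpha> - 1" using p by simp
  ultimately have "\<alpha> * (LBINT z:{0<..}. ?D2 z) + (\<alpha> - 1) * Beta ((\<alpha> + 1) / 2) (1 - \<alpha>) = - 1"
    by (simp only: b(2))
  then show "\<alpha> * (LBINT z:{0<..}. ?D2 z) = (1 - \<alpha>) * Beta ((\<alpha> + 1) / 2) (1 - \<alpha>) - 1"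
    by (simp add: left_diff_distrib)
qed

section \<open>The reflection formula and the normalising constant\<close>

lemma Gamma_reflection_real:
  fixes x :: real
  shows "Gamma x * Gamma (1 - x) = pi / sin (pi * x)"
proof -
  have "complex_of_real (Gamma x * Gamma (1 - x)) = complex_of_real (pi / sin (pi * x))"
    using Gamma_reflection_complex[of "of_real x"]
    by (simp add: Gamma_complex_of_real[symmetric] sin_of_real[symmetric])
  then show ?thesis
    by (simp only: of_real_eq_iff)
qed

text \<open>Reflection at (\<alpha> + 1) / 2 and at \<alpha>, the latter with the double-angle
  formula, gives two expressions for pi. Equating them and cancelling the cosine yields fact 3,
  which links the sine in \<open>K_const\<close> to the Gamma values in Beta.\<close>

lemma K_const_square:
  assumes "0 < \<alpha>" "\<alpha> < 1"
  shows "(K_const \<alpha> / Gamma ((\<alpha> + 1) / 2))\<^sup>2 * ((1 - \<alpha>) * Beta ((\<alpha> + 1) / 2) (1 - \<alpha>)) = \<alpha>"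
proof -
  define g where "g = Gamma ((\<alpha> + 1) / 2)"
  define h where "h = Gamma ((1 - \<alpha>) / 2)"
  have gh: "g > 0" "h > 0"
    using assms by (auto simp: g_def h_def)
  have s: "sin (\<alpha> * pi / 2) > 0" 
    using assms by (intro sin_gt_zero) auto
  have c: "cos (\<alpha> * pi / 2) > 0"
    using assms by (intro cos_gt_zero_pi) (auto intro: less_trans[of _ 0])
  have "g * h = pi / sin (pi * ((\<alpha> + 1) / 2))"
    using Gamma_reflection_real[of "(\<alpha> + 1) / 2"] by (simp add: g_def h_def field_simps)
  also have "sin (pi * ((\<alpha> + 1) / 2)) = cos (\<alpha> * pi / 2)"
    using sin_add[of "\<alpha> * pi / 2" "pi / 2"] by (simp add: algebra_simps add_divide_distrib)
  finally have 1: "g * h * cos (\<alpha> * pi / 2) = pi"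
    using c by (simp add: field_simps)
  have "Gamma \<alpha> * Gamma (1 - \<alpha>) = pi / sin (2 * (\<alpha> * pi / 2))"
    using Gamma_reflection_real[of \<alpha>] by (simp add: mult.commute)
  then have 2: "Gamma \<alpha> * Gamma (1 - \<alpha>) * (2 * sin (\<alpha> * pi / 2) * cos (\<alpha> * pi / 2)) = pi"
    unfolding sin_double using s c by (simp add: field_simps)
  have "Gamma \<alpha> * Gamma (1 - \<alpha>) * (2 * sin (\<alpha> * pi / 2)) * cos (\<alpha> * pi / 2)
      = g * h * cos (\<alpha> * pi / 2)"
    using 1 2 by (simp add: mult_ac)
  then have 3: "2 * sin (\<alpha> * pi / 2) * Gamma \<alpha> * Gamma (1 - \<alpha>) = g * h"
    using c by (simp add: mult_ac)
  have K: "(K_const \<alpha>)\<^sup>2 = \<alpha> * sin (\<alpha> * pi / 2) * Gamma \<alpha>"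
    unfolding K_const_def using assms s by (simp add: less_imp_le)
  \<comment> \<open>The denominator of Beta is Gamma ((3 - \<alpha>) / 2); one recurrence step
    reduces it to \<open>h\<close>.\<close>
  have "Gamma ((\<alpha> + 1) / 2 + (1 - \<alpha>)) = (1 - \<alpha>) / 2 * h"
    using Gamma_real_plus1[of "(1 - \<alpha>) / 2"] assms by (simp add: h_def field_simps)
  then have "Gamma ((\<alpha> + 1) / 2 + (1 - \<alpha>)) = (1 - \<alpha>) * (h / 2)" by simp
  then have B: "(1 - \<alpha>) * Beta ((\<alpha> + 1) / 2) (1 - \<alpha>) = 2 * g * Gamma (1 - \<alpha>) / h"
    unfolding Beta_def g_def[symmetric] using assms gh(2) by (simp only:) simp
  have "(K_const \<alpha> / g)\<^sup>2 * (2 * g * Gamma (1 - \<alpha>) / h)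
      = \<alpha> * (2 * sin (\<alpha> * pi / 2) * Gamma \<alpha> * Gamma (1 - \<alpha>)) / (g * h)"
    unfolding power_divide K using gh by (simp add: power2_eq_square field_simps)
  also have "\<dots> = \<alpha>"
    unfolding 3 using gh by simp
  finally show ?thesis
    unfolding B g_def .
qed

section \<open>Square integrals of the kernel increments\<close>

lemma borel_measurable_pos_powr [measurable]: "(\<lambda>u. pos_powr u p) \<in> borel_measurable borel"
  unfolding pos_powr_def by measurable

text \<open>Between -1 and 0 only the first power survives and contributes 1 / \<alpha>; for z > 0
  \<open>LBINT_powr_diff_square\<close> applies. After multiplication by \<alpha> the two constants
  1 and -1 cancel.\<close>

lemma LBINT_pos_powr_diff_square:
  assumes "0 < \<alpha>" "\<alpha> < 1" and p: "p = (\<alpha> - 1) / 2"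
  shows "\<alpha> * (LBINT z. (pos_powr (1 + z) p - pos_powr z p)\<^sup>2) = (1 - \<alpha>) * Beta ((\<alpha> + 1) / 2) (1 - \<alpha>)"
proof -
  let ?f = "\<lambda>z. (pos_powr (1 + z) p - pos_powr z p)\<^sup>2"
  let ?D = "\<lambda>z. indicator {0<..} z *\<^sub>R (z powr p - (1 + z) powr p)\<^sup>2"
  let ?E = "\<lambda>u::real. indicator {0<..<1} u *\<^sub>R (u powr (2 * p))"
  have E_eq: "?E = (\<lambda>u. indicator {0<..<1} u *\<^sub>R (u powr (\<alpha> - 1) * (1 - u) powr (1 - 1)))"
  proof
    have "2 * p = \<alpha> - 1" using p by simp
    then show "?E u = indicator {0<..<1} u *\<^sub>R (u powr (\<alpha> - 1) * (1 - u) powr (1 - 1))" for u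
      by (auto simp: indicator_def)
  qed
  have "Beta \<alpha> 1 = 1 / \<alpha>"
    using assms Gamma_real_plus1[of \<alpha>] Gamma_real_pos[OF assms(1)] by (simp add: Beta_def less_imp_neq[symmetric])
  then have E: "integrable lborel ?E" "(LBINT u. ?E u) = 1 / \<alpha>"
    unfolding E_eq using Beta_real_LBINT[of \<alpha> 1] assms
    by (simp_all only: set_integrable_def set_lebesgue_integral_def zero_less_one)
  have D: "integrable lborel ?D" "\<alpha> * (LBINT z. ?D z) = (1 - \<alpha>) * Beta ((\<alpha> + 1) / 2) (1 - \<alpha>) - 1"
    using LBINT_powr_diff_square[OF assms]
    by (simp_all only: set_integrable_def set_lebesgue_integral_def)
  \<comment> \<open>At z = 0 the left side is 1 and the right side 0, hence the passage to almost
    everywhere. The argument \<open>1 + 1 * z\<close> has the shape of the affine substitution used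
    below.\<close>
  have "?f z = ?E (1 + 1 * z) + ?D z" if "z \<noteq> 0" for z
    using that by (auto simp: pos_powr_def indicator_def power2_commute[of "z powr p"] powr_add[symmetric] power2_eq_square[of "(1 + z) powr p"])
  then have "AE z in lborel. ?f z = ?E (1 + 1 * z) + ?D z"
    using AE_lborel_singleton[of 0] by auto
  then have "(LBINT z. ?f z) = (LBINT z. ?E (1 + 1 * z) + ?D z)"
    by (intro integral_cong_AE) auto
  also have "\<dots> = (LBINT z. ?E (1 + 1 * z)) + (LBINT z. ?D z)"
    using E D by (intro Bochner_Integration.integral_add lborel_integrable_real_affine) auto
  also have "(LBINT z. ?E (1 + 1 * z)) = 1 / \<alpha>"
    using E(2) lborel_integral_real_affine[of 1 ?E 1] by simp
  finally have "(LBINT z. ?f z) = 1 / \<alpha> + (LBINT z. ?D z)" .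
  then have "\<alpha> * (LBINT z. ?f z) = 1 + \<alpha> * (LBINT z. ?D z)"
    using assms(1) by (simp only: distrib_left) simp
  with D(2) show ?thesis
    by linarith
qed

text \<open>The terms with -x cancel in the increment. Substituting x = s - h z with h = t - s, the
  homogeneity of the powers leaves a fixed integral times h^(1+2p) = h^\<alpha>, and
  \<open>K_const_square\<close> shows that the remaining constant is 1.\<close>

lemma LBINT_M_minus_ind_diff_less:
  assumes "0 < \<alpha>" "\<alpha> < 1" "s < t"
  shows "(LBINT x. (M_minus_ind \<alpha> t x - M_minus_ind \<alpha> s x)\<^sup>2) = (t - s) powr \<alpha>"
proof -
  define p where "p = (\<alpha> - 1) / 2"
  define h where "h = t - s"
  define C where "C = K_const \<alpha> / Gamma ((\<alpha> + 1) / 2)"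
  have h: "h > 0" using assms by (simp add: h_def)
  have pos_powr_mult: "pos_powr (h * u) p = h powr p * pos_powr u p" for u
    using h by (simp add: pos_powr_def powr_mult zero_less_mult_iff)
  have scale: "(M_minus_ind \<alpha> t (s + (- h) * z) - M_minus_ind \<alpha> s (s + (- h) * z))\<^sup>2
      = C\<^sup>2 * (h powr p)\<^sup>2 * (pos_powr (1 + z) p - pos_powr z p)\<^sup>2" for z
  proof -
    have "t - (s + (- h) * z) = h * (1 + z)" "s - (s + (- h) * z) = h * z"
      by (simp_all add: h_def algebra_simps)
    then have "M_minus_ind \<alpha> t (s + (- h) * z) - M_minus_ind \<alpha> s (s + (- h) * z)
        = C * (pos_powr (h * (1 + z)) p - pos_powr (h * z) p)"
      unfolding M_minus_ind_def C_def[symmetric] p_def[symmetric] by (simp only:) (simp add: algebra_simps)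
    also have "\<dots> = C * (h powr p) * (pos_powr (1 + z) p - pos_powr z p)"
      unfolding pos_powr_mult by (simp add: algebra_simps)
    finally show ?thesis by (simp only: power_mult_distrib)
  qed
  have "(LBINT x. (M_minus_ind \<alpha> t x - M_minus_ind \<alpha> s x)\<^sup>2)
      = h * (C\<^sup>2 * (h powr p)\<^sup>2 * (LBINT z. (pos_powr (1 + z) p - pos_powr z p)\<^sup>2))"
    using h lborel_integral_real_affine[of "- h" "\<lambda>x. (M_minus_ind \<alpha> t x - M_minus_ind \<alpha> s x)\<^sup>2" s]
    unfolding scale by simp
  also have "\<dots> = (h * (h powr p)\<^sup>2) * (C\<^sup>2 * ((1 - \<alpha>) * Beta ((\<alpha> + 1) / 2) (1 - \<alpha>))) / \<alpha>"
    unfolding LBINT_pos_powr_diff_square[OF assms(1,2) p_def, symmetric] using assms by simp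
  also have "\<dots> = h * (h powr p)\<^sup>2"
    using K_const_square[OF assms(1,2)] assms by (simp add: C_def)
  also have "\<dots> = h powr \<alpha>"
  proof -
    have "1 + 2 * p = \<alpha>" by (simp add: p_def field_simps)
    then show ?thesis
      using h by (simp add: powr_power powr_mult_base mult.commute)
  qed
  finally show ?thesis by (simp add: h_def)
qed

lemma LBINT_M_minus_ind_diff:
  assumes "0 < \<alpha>" "\<alpha> < 1"
  shows "(LBINT x. (M_minus_ind \<alpha> t x - M_minus_ind \<alpha> s x)\<^sup>2) = \<bar>t - s\<bar> powr \<alpha>"
proof (cases s t rule: linorder_cases)
  case less
  then show ?thesis using LBINT_M_minus_ind_diff_less[OF assms less] by simp
next
  case greater
  have "(LBINT x. (M_minus_ind \<alpha> t x - M_minus_ind \<alpha> s x)\<^sup>2)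
      = (LBINT x. (M_minus_ind \<alpha> s x - M_minus_ind \<alpha> t x)\<^sup>2)"
    by (intro Bochner_Integration.integral_cong refl power2_commute)
  then show ?thesis
    using LBINT_M_minus_ind_diff_less[OF assms greater] greater by simp
qed simp


section \<open>Convergence in the mean square\<close>

lemma deriv_funpow_lincomb:
  fixes f g :: "real \<Rightarrow> real"
  assumes "\<And>n x. (deriv ^^ n) f differentiable at x" "\<And>n x. (deriv ^^ n) g differentiable at x"
  shows "(deriv ^^ n) (\<lambda>x. a * f x + b * g x) = (\<lambda>x. a * (deriv ^^ n) f x + b * (deriv ^^ n) g x)"
proof (induction n)
  case (Suc n)
  have "((\<lambda>x. a * (deriv ^^ n) f x + b * (deriv ^^ n) g x) has_real_derivative
      a * deriv ((deriv ^^ n) f) x + b * deriv ((deriv ^^ n) g) x) (at x)" for x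
    using assms[of n x]
    by (intro DERIV_add DERIV_cmult) (simp_all add: DERIV_deriv_iff_real_differentiable)
  then show ?case
    unfolding funpow.simps o_apply Suc.IH by (intro ext DERIV_imp_deriv)
qed simp

lemma schwartz_lincomb:
  assumes "f \<in> schwartz" "g \<in> schwartz"
  shows "(\<lambda>x. a * f x + b * g x) \<in> schwartz"
proof -
  have diff: "(deriv ^^ n) f differentiable at x" "(deriv ^^ n) g differentiable at x" for n x
    using assms by (auto simp: schwartz_def)
  have "bounded (range (\<lambda>x. x ^ m * (a * (deriv ^^ n) f x + b * (deriv ^^ n) g x)))" for m n
  proof -
    have "bounded (range (\<lambda>x. x ^ m * (deriv ^^ n) f x))" "bounded (range (\<lambda>x. x ^ m * (deriv ^^ n) g x))"
      using assms by (auto simp: schwartz_def)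
    then have "bounded (range (\<lambda>x. a *\<^sub>R (x ^ m * (deriv ^^ n) f x) + b *\<^sub>R (x ^ m * (deriv ^^ n) g x)))"
      by (intro bounded_plus_comp bounded_scaleR_comp)
    then show ?thesis
      by (simp add: algebra_simps)
  qed
  with diff show ?thesis
    unfolding schwartz_def by (auto simp: deriv_funpow_lincomb)
qed

lemma borel_measurable_schwartz: "f \<in> schwartz \<Longrightarrow> f \<in> borel_measurable borel"
proof -
  assume "f \<in> schwartz"
  then have "(deriv ^^ 0) f differentiable at x" for x
    unfolding schwartz_def by blast
  then have "continuous_on UNIV f"
    by (intro continuous_at_imp_continuous_on) (auto intro: differentiable_imp_continuous_within)
  then show ?thesis
    by (rule borel_measurable_continuous_onI)
qed

text \<open>Differences of kernels and sums over coordinates are both built from this one operation,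
  so linearity of the extended pairing has to be proved only once.\<close>

definition lincomb :: "real \<Rightarrow> (real \<Rightarrow> real) ^ 'd \<Rightarrow> real \<Rightarrow> (real \<Rightarrow> real) ^ 'd \<Rightarrow> (real \<Rightarrow> real) ^ 'd" where
  "lincomb a \<phi> b \<psi> = (\<chi> i. (\<lambda>x. a * (\<phi> $ i) x + b * (\<psi> $ i) x))"

lemma dual_pairing_lincomb:
  assumes "w \<in> tempered_vec" "\<phi> \<in> schwartz_vec" "\<psi> \<in> schwartz_vec"
  shows "dual_pairing w (lincomb a \<phi> b \<psi>) = a * dual_pairing w \<phi> + b * dual_pairing w \<psi>"
proof -
  have "(w $ j) (\<lambda>x. a * (\<phi> $ j) x + b * (\<psi> $ j) x) = a * (w $ j) (\<phi> $ j) + b * (w $ j) (\<psi> $ j)" for j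
    using assms unfolding tempered_vec_def schwartz_vec_def tempered_def by blast
  then show ?thesis
    by (simp add: dual_pairing_def lincomb_def sum.distrib sum_distrib_left)
qed

text \<open>The preimage of a Borel set is a cylinder set with a single test function.\<close>

lemma borel_measurable_dual_pairing:
  assumes "mittag_leffler_measure \<beta> \<mu>" "\<phi> \<in> schwartz_vec"
  shows "(\<lambda>w. dual_pairing w \<phi>) \<in> borel_measurable \<mu>"
proof (rule measurableI)
  fix A :: "real set" assume A: "A \<in> sets borel"
  let ?P = "\<Pi>\<^sub>M i\<in>{..<1::nat}. borel :: real measure"
  have "(\<lambda>x. x 0) \<in> measurable ?P borel"
    by (intro measurable_component_singleton) simp
  from measurable_sets[OF this A] have "(\<lambda>x. x 0) -` A \<inter> space ?P \<in> sets ?P" .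
  moreover have "(\<lambda>w. dual_pairing w \<phi>) -` A \<inter> tempered_vec
    = {w \<in> tempered_vec. (\<lambda>i\<in>{..<1::nat}. dual_pairing w \<phi>) \<in> (\<lambda>x. x 0) -` A \<inter> space ?P}"
    by (auto simp: space_PiM)
  ultimately have "(\<lambda>w. dual_pairing w \<phi>) -` A \<inter> tempered_vec \<in> cylinder_sets"
    unfolding cylinder_sets_def using assms(2) by (intro CollectI exI[of _ 1] exI[of _ "\<lambda>_. \<phi>"]) blast
  then show "(\<lambda>w. dual_pairing w \<phi>) -` A \<inter> space \<mu> \<in> sets \<mu>"
    using assms(1) by (auto simp: mittag_leffler_measure_def)
qed simp

lemma L2_tendsto_lincomb:
  assumes [measurable]: "\<And>m. g m \<in> borel_measurable M" "\<And>m. k m \<in> borel_measurable M"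
      "f \<in> borel_measurable M" "h \<in> borel_measurable M"
    and "L2_tendsto M g f" "L2_tendsto M k h"
  shows "L2_tendsto M (\<lambda>m x. a * g m x + b * k m x) (\<lambda>x. a * f x + b * h x)"
proof -
  let ?I = "\<lambda>m. \<integral>\<^sup>+x. ennreal ((g m x - f x)\<^sup>2) \<partial>M" and ?J = "\<lambda>m. \<integral>\<^sup>+x. ennreal ((k m x - h x)\<^sup>2) \<partial>M"
  \<comment> \<open>Obtained from 2 (a u) (b v) \<le> (a u)^2 + (b v)^2; it separates the two
    errors.\<close>
  have le: "(a * u + b * v)\<^sup>2 \<le> 2 * a\<^sup>2 * u\<^sup>2 + 2 * b\<^sup>2 * v\<^sup>2" for u v :: real
    using sum_squares_bound[of "a * u" "b * v"] by (simp add: power2_eq_square algebra_simps)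
  have "(\<integral>\<^sup>+x. ennreal (((a * g m x + b * k m x) - (a * f x + b * h x))\<^sup>2) \<partial>M)
      \<le> (\<integral>\<^sup>+x. ennreal (2 * a\<^sup>2) * ennreal ((g m x - f x)\<^sup>2) + ennreal (2 * b\<^sup>2) * ennreal ((k m x - h x)\<^sup>2) \<partial>M)"
    for m
  proof (intro nn_integral_mono)
    fix x
    have "((a * g m x + b * k m x) - (a * f x + b * h x))\<^sup>2
        \<le> 2 * a\<^sup>2 * (g m x - f x)\<^sup>2 + 2 * b\<^sup>2 * (k m x - h x)\<^sup>2"
      using le[of "g m x - f x" "k m x - h x"] by (simp add: algebra_simps)
    then show "ennreal (((a * g m x + b * k m x) - (a * f x + b * h x))\<^sup>2)
        \<le> ennreal (2 * a\<^sup>2) * ennreal ((g m x - f x)\<^sup>2) + ennreal (2 * b\<^sup>2) * ennreal ((k m x - h x)\<^sup>2)"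
      by (simp add: ennreal_mult[symmetric] ennreal_plus[symmetric] ennreal_leI del: ennreal_plus)
  qed
  also have "\<dots> m = ennreal (2 * a\<^sup>2) * ?I m + ennreal (2 * b\<^sup>2) * ?J m" for m
    by (simp add: nn_integral_add nn_integral_cmult)
  finally have bound: "(\<integral>\<^sup>+x. ennreal (((a * g m x + b * k m x) - (a * f x + b * h x))\<^sup>2) \<partial>M)
      \<le> ennreal (2 * a\<^sup>2) * ?I m + ennreal (2 * b\<^sup>2) * ?J m" for m .
  have "(\<lambda>m. ennreal (2 * a\<^sup>2) * ?I m + ennreal (2 * b\<^sup>2) * ?J m)
      \<longlonglongrightarrow> ennreal (2 * a\<^sup>2) * 0 + ennreal (2 * b\<^sup>2) * 0"
    using assms(5,6) unfolding L2_tendsto_def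
    by (intro tendsto_add ennreal_tendsto_cmult) auto
  then have "(\<lambda>m. ennreal (2 * a\<^sup>2) * ?I m + ennreal (2 * b\<^sup>2) * ?J m) \<longlonglongrightarrow> 0"
    by simp
  from tendsto_sandwich[OF _ _ tendsto_const this] bound show ?thesis
    unfolding L2_tendsto_def by auto
qed

text \<open>\<open>L2_tendsto\<close> speaks of extended nonnegative integrals, which may be
  infinite for finitely many indices; integrability therefore holds only eventually.\<close>

lemma L2_tendsto_LINT:
  assumes [measurable]: "\<And>m. g m \<in> borel_measurable M" "f \<in> borel_measurable M"
    and lim: "L2_tendsto M g f"
  shows "eventually (\<lambda>m. integrable M (\<lambda>x. (g m x - f x)\<^sup>2)) sequentially"
    and "(\<lambda>m. \<integral>x. (g m x - f x)\<^sup>2 \<partial>M) \<longlonglongrightarrow> 0"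
proof -
  have "eventually (\<lambda>m. (\<integral>\<^sup>+x. ennreal ((g m x - f x)\<^sup>2) \<partial>M) < 1) sequentially"
    using lim unfolding L2_tendsto_def by (rule order_tendstoD) simp
  then show "eventually (\<lambda>m. integrable M (\<lambda>x. (g m x - f x)\<^sup>2)) sequentially"
    by eventually_elim (auto simp: integrable_iff_bounded intro: less_trans)
  \<comment> \<open>\<open>enn2real\<close> sends infinity to 0, as the Bochner integral does for a
    nonintegrable square, so the two sequences agree at every index.\<close>
  have "(\<lambda>m. enn2real (\<integral>\<^sup>+x. ennreal ((g m x - f x)\<^sup>2) \<partial>M)) \<longlonglongrightarrow> enn2real 0"
    using lim unfolding L2_tendsto_def by (intro tendsto_enn2real) auto
  then show "(\<lambda>m. \<integral>x. (g m x - f x)\<^sup>2 \<partial>M) \<longlonglongrightarrow> 0"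
    by (simp add: integral_eq_nn_integral)
qed

text \<open>A weight for Young's inequality \<open>2 |u v| \<le> \<delta> u\<^sup>2 + v\<^sup>2 / \<delta>\<close> that stays positive where \<open>d\<close> vanishes;
  it replaces the Cauchy-Schwarz inequality below.\<close>

lemma young_weight:
  fixes d :: "nat \<Rightarrow> real"
  assumes "d \<longlonglongrightarrow> 0" "\<And>m. d m \<ge> 0"
  obtains \<delta> where "\<delta> \<longlonglongrightarrow> 0" "\<And>m. \<delta> m > 0" "(\<lambda>m. d m / \<delta> m) \<longlonglongrightarrow> 0"
proof
  \<comment> \<open>The square root bounds the quotient by \<open>sqrt (d m)\<close>; the reciprocal
    keeps the weight positive.\<close>
  let ?\<delta> = "\<lambda>m. sqrt (d m) + inverse (real (Suc m))"
  have sq: "(\<lambda>m. sqrt (d m)) \<longlonglongrightarrow> 0"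
    using tendsto_real_sqrt[OF assms(1)] by simp
  show "?\<delta> \<longlonglongrightarrow> 0"
    using tendsto_add[OF sq LIMSEQ_inverse_real_of_nat] by simp
  show pos: "?\<delta> m > 0" for m
    using assms(2) by (intro add_nonneg_pos) auto
  have "d m / ?\<delta> m \<le> sqrt (d m)" for m
  proof -
    have "d m = sqrt (d m) * sqrt (d m)" using assms(2)[of m] by simp
    also have "\<dots> \<le> sqrt (d m) * ?\<delta> m" using assms(2)[of m] by (intro mult_left_mono) auto
    finally show ?thesis using pos[of m] by (simp add: pos_divide_le_eq)
  qed
  moreover have "0 \<le> d m / ?\<delta> m" for m
    using assms(2)[of m] pos[of m] by (intro divide_nonneg_pos)
  ultimately show "(\<lambda>m. d m / ?\<delta> m) \<longlonglongrightarrow> 0"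
    by (auto intro: tendsto_sandwich[OF _ _ tendsto_const sq])
qed

text \<open>With h = g - f one has g^2 - f^2 = h^2 + 2 f h. Young's inequality with the weight
  \<delta> bounds the mixed term by quantities whose integrals tend to 0.\<close>

lemma L2_tendsto_LINT_square:
  assumes g [measurable]: "\<And>m. g m \<in> borel_measurable M" and f: "f \<in> L2_fun M"
    and lim: "L2_tendsto M g f"
  shows "(\<lambda>m. \<integral>x. (g m x)\<^sup>2 \<partial>M) \<longlonglongrightarrow> (\<integral>x. (f x)\<^sup>2 \<partial>M)"
proof -
  have f' [measurable]: "f \<in> borel_measurable M" and intf: "integrable M (\<lambda>x. (f x)\<^sup>2)"
    using f by (auto simp: L2_fun_def)
  let ?d = "\<lambda>m. \<integral>x. (g m x - f x)\<^sup>2 \<partial>M"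
  note d = L2_tendsto_LINT[OF g f' lim]
  obtain \<delta> where \<delta>: "\<delta> \<longlonglongrightarrow> 0" "\<And>m. \<delta> m > 0" "(\<lambda>m. ?d m / \<delta> m) \<longlonglongrightarrow> 0"
    using young_weight[OF d(2)] by auto
  let ?F = "\<integral>x. (f x)\<^sup>2 \<partial>M"
  have "eventually (\<lambda>m. norm ((\<integral>x. (g m x)\<^sup>2 \<partial>M) - ?F) \<le> ?d m + \<delta> m * ?F + ?d m / \<delta> m) sequentially"
    using d(1)
  proof eventually_elim
    case (elim m)
    let ?h = "\<lambda>x. g m x - f x"
    have bound: "\<bar>(g m x)\<^sup>2 - (f x)\<^sup>2\<bar> \<le> (?h x)\<^sup>2 + \<delta> m * (f x)\<^sup>2 + (?h x)\<^sup>2 / \<delta> m" for x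
    proof -
      \<comment> \<open>Writing f h as (s f) (h / s) brings the weight into the unweighted
        inequality.\<close>
      define s where "s = sqrt (\<delta> m)"
      have s: "s > 0" "s\<^sup>2 = \<delta> m" using \<delta>(2)[of m] by (auto simp: s_def)
      have "\<bar>2 * f x * ?h x\<bar> = 2 * \<bar>s * f x\<bar> * \<bar>?h x / s\<bar>"
        using s by (simp add: abs_mult)
      also have "\<dots> \<le> (s * f x)\<^sup>2 + (?h x / s)\<^sup>2"
        using sum_squares_bound[of "\<bar>s * f x\<bar>" "\<bar>?h x / s\<bar>"] by (simp only: power2_abs)
      also have "\<dots> = \<delta> m * (f x)\<^sup>2 + (?h x)\<^sup>2 / \<delta> m"
        by (simp add: power_mult_distrib power_divide s(2))
      finally have "\<bar>2 * f x * ?h x\<bar> \<le> \<delta> m * (f x)\<^sup>2 + (?h x)\<^sup>2 / \<delta> m" .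
      moreover have "(g m x)\<^sup>2 - (f x)\<^sup>2 = (?h x)\<^sup>2 + 2 * f x * ?h x"
        by (simp add: power2_eq_square algebra_simps)
      ultimately show ?thesis
        using zero_le_power2[of "?h x"] by linarith
    qed
    have int: "integrable M (\<lambda>x. (?h x)\<^sup>2 + \<delta> m * (f x)\<^sup>2 + (?h x)\<^sup>2 / \<delta> m)"
      using elim intf by auto
    have diff: "integrable M (\<lambda>x. (g m x)\<^sup>2 - (f x)\<^sup>2)"
      by (rule Bochner_Integration.integrable_bound[OF int])
        (use bound in \<open>auto intro: order_trans[OF _ abs_ge_self]\<close>)
    from Bochner_Integration.integrable_add[OF this intf] have "integrable M (\<lambda>x. (g m x)\<^sup>2)"
      by simp
    then have "norm ((\<integral>x. (g m x)\<^sup>2 \<partial>M) - ?F) = \<bar>\<integral>x. (g m x)\<^sup>2 - (f x)\<^sup>2 \<partial>M\<bar>"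
      using intf by simp
    also have "\<dots> \<le> (\<integral>x. \<bar>(g m x)\<^sup>2 - (f x)\<^sup>2\<bar> \<partial>M)"
      by (rule integral_abs_bound)
    also have "\<dots> \<le> (\<integral>x. (?h x)\<^sup>2 + \<delta> m * (f x)\<^sup>2 + (?h x)\<^sup>2 / \<delta> m \<partial>M)"
      using int diff bound by (intro integral_mono) auto
    also have "\<dots> = ?d m + \<delta> m * ?F + ?d m / \<delta> m"
      using elim intf by simp
    finally show ?case .
  qed
  moreover have "(\<lambda>m. ?d m + \<delta> m * ?F + ?d m / \<delta> m) \<longlonglongrightarrow> 0 + 0 * ?F + 0"
    by (intro tendsto_intros d \<delta>)
  then have "(\<lambda>m. ?d m + \<delta> m * ?F + ?d m / \<delta> m) \<longlonglongrightarrow> 0"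
    by simp
  ultimately show ?thesis
    by (rule Lim_null_comparison[THEN LIM_zero_cancel])
qed

lemma norm_iexp_diff_le: "norm (iexp a - iexp b) \<le> \<bar>a - b\<bar>"
proof -
  have "iexp a - iexp b = iexp b * (iexp (a - b) - 1)"
    by (simp add: right_diff_distrib exp_add[symmetric] algebra_simps)
  then have "norm (iexp a - iexp b) = norm (iexp (a - b) - 1)"
    by (simp add: norm_mult)
  also have "\<dots> \<le> \<bar>a - b\<bar>"
    using iexp_approx1[of "a - b" 0] by simp
  finally show ?thesis .
qed

text \<open>The map \<open>iexp\<close> is 1-Lipschitz, and the first-order distance is bounded by
  \<open>\<delta> m\<close> plus the squared distance over \<open>\<delta> m\<close>; total mass 1
  makes the constant integrate to itself.\<close>

lemma (in prob_space) L2_tendsto_LINT_iexp: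
  assumes g [measurable]: "\<And>m. g m \<in> borel_measurable M" and f [measurable]: "f \<in> borel_measurable M"
    and lim: "L2_tendsto M g f"
  shows "(\<lambda>m. \<integral>x. iexp (g m x) \<partial>M) \<longlonglongrightarrow> (\<integral>x. iexp (f x) \<partial>M)"
proof -
  let ?d = "\<lambda>m. \<integral>x. (g m x - f x)\<^sup>2 \<partial>M"
  note d = L2_tendsto_LINT[OF g f lim]
  obtain \<delta> where \<delta>: "\<delta> \<longlonglongrightarrow> 0" "\<And>m. \<delta> m > 0" "(\<lambda>m. ?d m / \<delta> m) \<longlonglongrightarrow> 0"
    using young_weight[OF d(2)] by auto
  have int: "integrable M (\<lambda>x. iexp (u x))" if [measurable]: "u \<in> borel_measurable M" for u
    by (rule integrable_const_bound[of _ 1]) auto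
  have "eventually (\<lambda>m. norm ((\<integral>x. iexp (g m x) \<partial>M) - (\<integral>x. iexp (f x) \<partial>M)) \<le> \<delta> m + ?d m / \<delta> m) sequentially"
    using d(1)
  proof eventually_elim
    case (elim m)
    have bound: "norm (iexp (g m x) - iexp (f x)) \<le> \<delta> m + (g m x - f x)\<^sup>2 / \<delta> m" for x
    proof -
      have "\<bar>h\<bar> \<le> \<delta> m + h\<^sup>2 / \<delta> m" for h
      proof (cases "\<bar>h\<bar> \<le> \<delta> m")
        case True
        then show ?thesis using \<delta>(2)[of m] by (intro add_increasing2) auto
      next
        case False
        then have "\<bar>h\<bar> * \<delta> m \<le> \<bar>h\<bar> * \<bar>h\<bar>" by (intro mult_left_mono) auto
        then have "\<bar>h\<bar> \<le> h\<^sup>2 / \<delta> m"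
          using \<delta>(2)[of m] by (simp add: pos_le_divide_eq power2_eq_square)
        then show ?thesis using \<delta>(2)[of m] by linarith
      qed
      then show ?thesis by (rule order_trans[OF norm_iexp_diff_le])
    qed
    have "norm ((\<integral>x. iexp (g m x) \<partial>M) - (\<integral>x. iexp (f x) \<partial>M)) = norm (\<integral>x. iexp (g m x) - iexp (f x) \<partial>M)"
      using int by simp
    also have "\<dots> \<le> (\<integral>x. norm (iexp (g m x) - iexp (f x)) \<partial>M)"
      by (rule integral_norm_bound)
    also have "\<dots> \<le> (\<integral>x. \<delta> m + (g m x - f x)\<^sup>2 / \<delta> m \<partial>M)"
      using elim bound int by (intro integral_mono) auto
    also have "\<dots> = \<delta> m + ?d m / \<delta> m"
      using elim by (simp add: prob_space)
    finally show ?case .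
  qed
  moreover have "(\<lambda>m. \<delta> m + ?d m / \<delta> m) \<longlonglongrightarrow> 0 + 0"
    by (intro tendsto_intros \<delta>)
  then have "(\<lambda>m. \<delta> m + ?d m / \<delta> m) \<longlonglongrightarrow> 0"
    by simp
  ultimately show ?thesis
    by (rule Lim_null_comparison[THEN LIM_zero_cancel])
qed

section \<open>Linearity and characteristic function of the extended pairing\<close>

lemma L2_fun_lincomb:
  assumes "f \<in> L2_fun M" "g \<in> L2_fun M"
  shows "(\<lambda>x. a * f x + b * g x) \<in> L2_fun M"
proof -
  have [measurable]: "f \<in> borel_measurable M" "g \<in> borel_measurable M"
    and int: "integrable M (\<lambda>x. 2 * a\<^sup>2 * (f x)\<^sup>2 + 2 * b\<^sup>2 * (g x)\<^sup>2)"
    using assms by (auto simp: L2_fun_def)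
  have "(a * u + b * v)\<^sup>2 \<le> 2 * a\<^sup>2 * u\<^sup>2 + 2 * b\<^sup>2 * v\<^sup>2" for u v :: real
    using sum_squares_bound[of "a * u" "b * v"] by (simp add: power2_eq_square algebra_simps)
  then have "integrable M (\<lambda>x. (a * f x + b * g x)\<^sup>2)"
    by (intro Bochner_Integration.integrable_bound[OF int])
      (auto intro: order_trans[OF _ abs_ge_self])
  then show ?thesis by (simp add: L2_fun_def)
qed

text \<open>The same linear combination of the two approximating sequences approximates both the
  function and the random variable.\<close>

lemma extended_pairing_lincomb:
  assumes \<mu>: "mittag_leffler_measure \<beta> \<mu>"
    and "extended_pairing \<mu> f X" "extended_pairing \<mu> g Y"
  shows "extended_pairing \<mu> (lincomb a f b g) (\<lambda>w. a * X w + b * Y w)"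
proof -
  obtain \<phi> \<psi> where
    f: "\<And>j. f $ j \<in> L2_fun lborel" "X \<in> L2_fun \<mu>" "\<And>m. \<phi> m \<in> schwartz_vec"
      "\<And>j. L2_tendsto lborel (\<lambda>m. \<phi> m $ j) (f $ j)" "L2_tendsto \<mu> (\<lambda>m w. dual_pairing w (\<phi> m)) X" and
    g: "\<And>j. g $ j \<in> L2_fun lborel" "Y \<in> L2_fun \<mu>" "\<And>m. \<psi> m \<in> schwartz_vec"
      "\<And>j. L2_tendsto lborel (\<lambda>m. \<psi> m $ j) (g $ j)" "L2_tendsto \<mu> (\<lambda>m w. dual_pairing w (\<psi> m)) Y"
    using assms(2,3) unfolding extended_pairing_def by blast
  let ?\<chi> = "\<lambda>m. lincomb a (\<phi> m) b (\<psi> m)"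
  have space: "space \<mu> = tempered_vec"
    using \<mu> by (simp add: mittag_leffler_measure_def)
  have "lincomb a f b g $ j \<in> L2_fun lborel" for j
    using L2_fun_lincomb[OF f(1) g(1)] by (simp add: lincomb_def)
  moreover have "?\<chi> m \<in> schwartz_vec" for m
    using f(3)[of m] g(3)[of m] by (auto simp: schwartz_vec_def lincomb_def intro: schwartz_lincomb)
  moreover have "L2_tendsto lborel (\<lambda>m. ?\<chi> m $ j) (lincomb a f b g $ j)" for j
  proof -
    have "\<phi> m $ j \<in> borel_measurable lborel" "\<psi> m $ j \<in> borel_measurable lborel" for m
      using f(3)[of m] g(3)[of m] by (simp_all add: schwartz_vec_def borel_measurable_schwartz)
    moreover have "f $ j \<in> borel_measurable lborel" "g $ j \<in> borel_measurable lborel"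
      using f(1)[of j] g(1)[of j] by (simp_all add: L2_fun_def)
    ultimately show ?thesis
      unfolding lincomb_def vec_lambda_beta by (rule L2_tendsto_lincomb[OF _ _ _ _ f(4) g(4)])
  qed
  moreover have "X \<in> borel_measurable \<mu>" "Y \<in> borel_measurable \<mu>"
    using f(2) g(2) by (simp_all add: L2_fun_def)
  then have "L2_tendsto \<mu> (\<lambda>m w. a * dual_pairing w (\<phi> m) + b * dual_pairing w (\<psi> m)) (\<lambda>w. a * X w + b * Y w)"
    by (intro L2_tendsto_lincomb[OF _ _ _ _ f(5) g(5)] borel_measurable_dual_pairing[OF \<mu>] f(3) g(3))
  \<comment> \<open>The pairing is linear only for tempered functionals, but these make up the whole
    space of \<open>\<mu>\<close>.\<close>
  then have "L2_tendsto \<mu> (\<lambda>m w. dual_pairing w (?\<chi> m)) (\<lambda>w. a * X w + b * Y w)"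
  proof -
    have "(\<integral>\<^sup>+w. ennreal ((dual_pairing w (?\<chi> m) - (a * X w + b * Y w))\<^sup>2) \<partial>\<mu>)
        = (\<integral>\<^sup>+w. ennreal ((a * dual_pairing w (\<phi> m) + b * dual_pairing w (\<psi> m) - (a * X w + b * Y w))\<^sup>2) \<partial>\<mu>)" for m
      by (intro nn_integral_cong) (simp add: space dual_pairing_lincomb f(3) g(3))
    then show "L2_tendsto \<mu> (\<lambda>m w. a * dual_pairing w (\<phi> m) + b * dual_pairing w (\<psi> m)) (\<lambda>w. a * X w + b * Y w)
        \<Longrightarrow> ?thesis"
      unfolding L2_tendsto_def by simp
  qed
  moreover have "(\<lambda>w. a * X w + b * Y w) \<in> L2_fun \<mu>"
    using f(2) g(2) by (rule L2_fun_lincomb)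
  ultimately show ?thesis
    unfolding extended_pairing_def by (intro conjI allI exI[of _ ?\<chi>]) auto
qed

text \<open>Induction from singletons, where \<open>f j\<close> is combined with itself at weight 0;
  the zero function then needs no separate treatment.\<close>

lemma extended_pairing_sum:
  assumes \<mu>: "mittag_leffler_measure \<beta> \<mu>"
    and "finite A" "A \<noteq> {}" "\<And>j. j \<in> A \<Longrightarrow> extended_pairing \<mu> (f j) (X j)"
  shows "extended_pairing \<mu> (\<chi> i. (\<lambda>x. \<Sum>j\<in>A. c j * (f j $ i) x)) (\<lambda>w. \<Sum>j\<in>A. c j * X j w)"
  using assms(2-)
proof (induction A rule: finite_ne_induct)
  case (singleton j)
  then show ?case
    using extended_pairing_lincomb[OF \<mu>, of "f j" "X j" "f j" "X j" "c j" 0] by (simp add: lincomb_def)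
next
  case (insert j A)
  then show ?case
    using extended_pairing_lincomb[OF \<mu> insert.prems[OF insertI1] insert.IH, of "c j" 1]
    by (simp add: lincomb_def)
qed

text \<open>The defining identity of the measure passes to the limit along the approximating
  Schwartz functions: the expectations converge by convergence in \<open>\<mu>\<close>, the right
  sides by convergence of the norms and continuity of the Mittag-Leffler function.\<close>

lemma extended_pairing_char:
  assumes \<mu>: "mittag_leffler_measure \<beta> \<mu>" and "0 < \<beta>" and "extended_pairing \<mu> f X"
  shows "(\<integral>w. iexp (X w) \<partial>\<mu>) = of_real (mittag_leffler_real \<beta> 1 (- (1 / 2) * sq_norm0 f))"
proof -
  interpret prob_space \<mu> using \<mu> by (simp add: mittag_leffler_measure_def)
  obtain \<phi> where
    f: "\<And>j. f $ j \<in> L2_fun lborel" "X \<in> L2_fun \<mu>" and \<phi>: "\<And>m. \<phi> m \<in> schwartz_vec"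
    and lim: "\<And>j. L2_tendsto lborel (\<lambda>m. \<phi> m $ j) (f $ j)" "L2_tendsto \<mu> (\<lambda>m w. dual_pairing w (\<phi> m)) X"
    using assms(3) unfolding extended_pairing_def by blast
  have "(\<lambda>m. sq_norm0 (\<phi> m)) \<longlonglongrightarrow> sq_norm0 f"
    unfolding sq_norm0_def using \<phi>
    by (intro tendsto_sum L2_tendsto_LINT_square f lim)
      (auto simp: schwartz_vec_def intro: borel_measurable_schwartz)
  moreover have "continuous_on UNIV (\<lambda>x. mittag_leffler_real \<beta> 1 (- (1 / 2) * x))"
    using assms(2) by (intro continuous_intros) auto
  ultimately have "(\<lambda>m. mittag_leffler_real \<beta> 1 (- (1 / 2) * sq_norm0 (\<phi> m)))
      \<longlonglongrightarrow> mittag_leffler_real \<beta> 1 (- (1 / 2) * sq_norm0 f)"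
    by (intro continuous_on_tendsto_compose[of UNIV "\<lambda>x. mittag_leffler_real \<beta> 1 (- (1 / 2) * x)"]) auto
  then have "(\<lambda>m. complex_of_real (mittag_leffler_real \<beta> 1 (- (1 / 2) * sq_norm0 (\<phi> m))))
      \<longlonglongrightarrow> of_real (mittag_leffler_real \<beta> 1 (- (1 / 2) * sq_norm0 f))"
    by (rule tendsto_of_real)
  moreover have "complex_of_real (mittag_leffler_real \<beta> 1 (- (1 / 2) * sq_norm0 (\<phi> m)))
      = (\<integral>w. iexp (dual_pairing w (\<phi> m)) \<partial>\<mu>)" for m
    using \<mu> \<phi>[of m] mittag_leffler_of_real[OF assms(2), of 1]
    by (simp add: mittag_leffler_measure_def del: of_real_minus of_real_mult of_real_divide)
  moreover have "(\<lambda>m. \<integral>w. iexp (dual_pairing w (\<phi> m)) \<partial>\<mu>) \<longlonglongrightarrow> (\<integral>w. iexp (X w) \<partial>\<mu>)"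
    using f(2) \<phi> by (intro L2_tendsto_LINT_iexp lim borel_measurable_dual_pairing[OF \<mu>])
      (auto simp: L2_fun_def)
  ultimately show ?thesis
    using LIMSEQ_unique by auto
qed


section \<open>The form factor\<close>

text \<open>By linearity the exponent represents the pairing with \<open>F\<close>, whose i-th
  component is \<open>k $ i\<close> times one common kernel increment. Its squared norm therefore
  factors into that of \<open>k\<close> and that of the increment.\<close>

lemma gen_grey_brownian_char:
  fixes k :: "real ^ 'd"
  assumes \<mu>: "mittag_leffler_measure \<beta> \<mu>" and B: "gen_grey_brownian \<mu> \<alpha> B"
    and "0 < \<beta>" "0 < \<alpha>" "\<alpha> < 1" "0 \<le> t" "0 \<le> s"
  shows "(\<integral>w. iexp (k \<bullet> (B t w - B s w)) \<partial>\<mu>)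
    = of_real (mittag_leffler_real \<beta> 1 (- ((norm k)\<^sup>2 / 2) * \<bar>t - s\<bar> powr \<alpha>))"
proof -
  define f where "f j = lincomb 1 (at_coord j (M_minus_ind \<alpha> t)) (- 1) (at_coord j (M_minus_ind \<alpha> s))"
    for j :: 'd
  \<comment> \<open>The coefficients 1 and -1 are kept to match the form of
    \<open>extended_pairing_lincomb\<close>.\<close>
  define X where "X j = (\<lambda>w. 1 * B t w $ j + (- 1) * B s w $ j)" for j
  define F where "F = (\<chi> i. (\<lambda>x. \<Sum>j\<in>UNIV. k $ j * (f j $ i) x))"
  have "extended_pairing \<mu> (f j) (X j)" for j
    unfolding f_def X_def using B assms(6,7)
    by (intro extended_pairing_lincomb[OF \<mu>]) (simp_all add: gen_grey_brownian_def)
  then have "extended_pairing \<mu> F (\<lambda>w. \<Sum>j\<in>UNIV. k $ j * X j w)"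
    unfolding F_def by (intro extended_pairing_sum[OF \<mu>]) auto
  note char = extended_pairing_char[OF \<mu> assms(3) this]
  have X: "(\<Sum>j\<in>UNIV. k $ j * X j w) = k \<bullet> (B t w - B s w)" for w
    by (simp add: X_def inner_vec_def)
  have "(f j $ i) x = (if j = i then M_minus_ind \<alpha> t x - M_minus_ind \<alpha> s x else 0)" for i j x
    by (auto simp: f_def lincomb_def at_coord_def)
  then have F: "(F $ i) x = k $ i * (M_minus_ind \<alpha> t x - M_minus_ind \<alpha> s x)" for i x
    by (simp add: F_def if_distrib[of "\<lambda>y. _ * y"] cong: if_cong)
  have "sq_norm0 F = (\<Sum>i\<in>UNIV. (k $ i)\<^sup>2 * \<bar>t - s\<bar> powr \<alpha>)"
    unfolding sq_norm0_def F power_mult_distrib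
    using LBINT_M_minus_ind_diff[OF assms(4,5)] by simp
  also have "\<dots> = (norm k)\<^sup>2 * \<bar>t - s\<bar> powr \<alpha>"
    unfolding power2_norm_eq_inner inner_vec_def sum_distrib_right by (simp add: power2_eq_square)
  finally show ?thesis
    using char unfolding X by simp
qed

theorem mainTheorem3:
  fixes \<beta> y :: real and n :: nat and k :: "real ^ 'd"
    and \<mu> :: "(((real \<Rightarrow> real) \<Rightarrow> real) ^ 'd) measure"
    and B :: "real \<Rightarrow> ((real \<Rightarrow> real) \<Rightarrow> real) ^ 'd \<Rightarrow> real ^ 'd"
  assumes "n \<ge> 1" and "0 < \<beta>" and "\<beta> < 1"
    and "mittag_leffler_measure \<beta> \<mu>"
    and "gen_grey_brownian \<mu> \<beta> B"
    and "y\<^sup>2 = real n powr \<beta> * (norm k)\<^sup>2 / 2"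
  shows "form_factor \<mu> B n k = complex_of_real (debye \<beta> y) \<and>
         complex_of_real (debye \<beta> y) = 2 * mittag_leffler \<beta> 3 (complex_of_real (- (y\<^sup>2)))"
proof
  let ?n = "real n"
  define c where "c = - ((norm k)\<^sup>2 / 2)"
  let ?E = "\<lambda>\<rho> x. mittag_leffler_real \<beta> \<rho> (c * x powr \<beta>)"
  \<comment> \<open>Identifies the Mittag-Leffler argument at the right endpoint with that of the
    Debye function.\<close>
  have y: "c * ?n powr \<beta> = - (y\<^sup>2)"
    using assms(6) by (simp add: c_def)
  have inner: "(LBINT s:{0..?n}. (\<integral>w. exp (\<i> * complex_of_real (k \<bullet> (B t w - B s w))) \<partial>\<mu>))
      = of_real (t * ?E 2 \<bar>t\<bar> + (?n - t) * ?E 2 \<bar>?n - t\<bar>)" if t: "t \<in> {0..?n}" for t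
  proof -
    have "(LBINT s:{0..?n}. (\<integral>w. exp (\<i> * complex_of_real (k \<bullet> (B t w - B s w))) \<partial>\<mu>))
        = (LBINT s:{0..?n}. complex_of_real (?E 1 \<bar>t - s\<bar>))"
      using t gen_grey_brownian_char[OF assms(4,5,2,2,3)]
      by (intro set_lebesgue_integral_cong) (simp_all add: c_def)
    then show ?thesis
      using LBINT_mittag_leffler_abs_diff[OF assms(2), of t ?n c] t
      by (simp only: set_integral_complex_of_real atLeastAtMost_iff)
  qed
  have "(LBINT t:{0..?n}. LBINT s:{0..?n}. (\<integral>w. exp (\<i> * complex_of_real (k \<bullet> (B t w - B s w))) \<partial>\<mu>))
      = (LBINT t:{0..?n}. complex_of_real (t * ?E 2 \<bar>t\<bar> + (?n - t) * ?E 2 \<bar>?n - t\<bar>))"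
    using inner by (intro set_lebesgue_integral_cong) simp_all
  also have "\<dots> = of_real (2 * ?n\<^sup>2 * ?E 3 ?n)"
    unfolding set_integral_complex_of_real using LBINT_mittag_leffler_two[OF assms(2), of ?n c] by simp
  finally have "form_factor \<mu> B n k = 1 / (of_nat n)\<^sup>2 * of_real (2 * ?n\<^sup>2 * ?E 3 ?n)"
    by (simp only: form_factor_def)
  \<comment> \<open>Since n \<ge> 1, the factor n^2 is nonzero and cancels.\<close>
  also have "\<dots> = of_real (2 * ?E 3 ?n)"
    using assms(1) by simp
  also have "2 * ?E 3 ?n = debye \<beta> y"
    unfolding y using debye_eq_mittag_leffler_real[OF assms(2)] by simp
  finally show "form_factor \<mu> B n k = complex_of_real (debye \<beta> y)" .
  show "complex_of_real (debye \<beta> y) = 2 * mittag_leffler \<beta> 3 (complex_of_real (- (y\<^sup>2)))"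
    using mittag_leffler_of_real[OF assms(2), of 3 "- (y\<^sup>2)"]
    by (simp add: debye_eq_mittag_leffler_real[OF assms(2)])
qed


end
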